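(* Let $n\ge1$, let $\sigma\subseteq\{1,\dots,n\}$, and let $T=T(n,\sigma)$ be the corresponding threshold graph on $n+1$ vertices, with Betti sequence $\beta(T)=(\beta_1(T),\dots,\beta_n(T))$. Then for every $1\le k\le n$, $$\beta_k(T)=\sum_{uv\in E^\beta_k(\overline{T})}\binom{v}{u+1}\binom{i_T(v)}{k-u-1},\qquad\text{where } E^\beta_k(\overline{T})=\{uv\notin E(T)\mid k\in\ell_\beta(uv)\},$$ and in each summand the non-edge $uv$ is written with $u<v$.
   Context: For $n\ge 1$ and $\sigma\subseteq\{1,\dots,n\}$, $T(n,\sigma)$ is the graph with vertex set $\{0,1,\dots,n\}$ in which, for $0\le u<v\le n$, the pair $uv$ is an edge if and only if $v\notin\sigma$. (Every threshold graph on $n+1$ vertices is isomorphic to exactly one $T(n,\sigma)$, and threshold graphs are always labeled in this way.) $\overline{T}$ denotes the complement graph of $T$; its edges are the non-edges $uv$ ($u\neq v$) of $T$. For a vertex $v$ of $T=T(n,\sigma)$, let $i_T(v)=|\{w\in\sigma\mid w>v\}|$. The $\beta$-labeling of the non-edges of $T$ assigns to each non-edge $uv$ with $u<v$ the set $\ell_\beta(uv)=\{u+1,u+2,\dots,u+1+i_T(v)\}$. Betti sequence: let $\Bbbk$ be a field, $R=\Bbbk[x_0,\dots,x_n]$, $I_c(T)=\langle x_ux_v\mid u\neq v,\ uv\notin E(T)\rangle$ and $\Bbbk[T]=R/I_c(T)$. The ideal $I_c(T)$ is $2$-linear, i.e. the graded Betti numbers $\beta_{i,j}(\Bbbk[T])$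 vanish unless $j=i+1$ or $(i,j)=(0,0)$. The Betti sequence of $T$ is $\beta(T)=(\beta_1(T),\dots,\beta_n(T))$ with $\beta_i(T)=\beta_{i,i+1}(\Bbbk[T])$. *)

theory Defs
  imports
    "HOL-Library.Poly_Mapping"
    "HOL-Algebra.Ideal"
    "Jordan_Normal_Form.Matrix"
begin

section \<open>Polynomial rings\<close>

text \<open>
  The type below has infinitely many variables \<open>x\<^sub>0, x\<^sub>1, \<dots>\<close>; a monomial is the finitely supported
  function giving its exponents. The ring \<open>\<bbbk>[x\<^sub>v | v \<in> V]\<close> is the subring of the polynomials that
  involve no variable outside \<open>V\<close>.
\<close>

type_synonym 'a mpoly = "(nat \<Rightarrow>\<^sub>0 nat) \<Rightarrow>\<^sub>0 'a"

definition polys :: "nat set \<Rightarrow> ('a::zero) mpoly set" where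
  "polys V = {p. \<forall>m \<in> Poly_Mapping.keys p. Poly_Mapping.keys m \<subseteq> V}"

definition poly_ring :: "nat set \<Rightarrow> ('a::comm_ring_1) mpoly ring" where
  "poly_ring V = \<lparr>carrier = polys V, monoid.mult = (*), one = 1, zero = 0, add = (+)\<rparr>"

definition var :: "nat \<Rightarrow> ('a::zero_neq_one) mpoly" where
  "var v = Poly_Mapping.single (Poly_Mapping.single v 1) 1"

definition mon_degree :: "(nat \<Rightarrow>\<^sub>0 nat) \<Rightarrow> nat" where
  "mon_degree m = (\<Sum>v \<in> Poly_Mapping.keys m. Poly_Mapping.lookup m v)"

text \<open>
  Zero is homogeneous of every degree. Degrees are integers, so that a homogeneous polynomial of
  negative degree is zero.
\<close>

definition homogeneous :: "int \<Rightarrow> ('a::zero) mpoly \<Rightarrow> bool" where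
  "homogeneous d p \<longleftrightarrow> (\<forall>m \<in> Poly_Mapping.keys p. int (mon_degree m) = d)"

definition irrelevant_ideal :: "nat set \<Rightarrow> ('a::comm_ring_1) mpoly set" where
  "irrelevant_ideal V = Idl\<^bsub>poly_ring V\<^esub> (var ` V)"

lemma polys_closed:
  fixes p q :: "('a::comm_ring_1) mpoly"
  assumes "p \<in> polys V" and "q \<in> polys V"
  shows "p + q \<in> polys V" and "p * q \<in> polys V" and "- p \<in> polys V"
proof -
  have sub: "Poly_Mapping.keys (a + b) \<subseteq> V"
    if "Poly_Mapping.keys a \<subseteq> V" "Poly_Mapping.keys b \<subseteq> V" for a b :: "nat \<Rightarrow>\<^sub>0 nat"
    using that Poly_Mapping.keys_add[of a b] by blast
  show "p + q \<in> polys V"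
    using assms Poly_Mapping.keys_add[of p q] unfolding polys_def by blast
  show "p * q \<in> polys V"
    using assms keys_mult[of p q] sub unfolding polys_def by blast
  show "- p \<in> polys V"
    using assms unfolding polys_def by (simp add: in_keys_iff)
qed

lemma cring_poly_ring: "cring (poly_ring V :: ('a::comm_ring_1) mpoly ring)"
proof (rule cringI)
  have zero: "0 \<in> polys V" and one: "1 \<in> polys V"
    by (simp_all add: polys_def)
  show "abelian_group (poly_ring V :: 'a mpoly ring)"
  proof (rule abelian_groupI)
    fix x :: "'a mpoly"
    assume "x \<in> carrier (poly_ring V)"
    then have "- x \<in> polys V"
      using polys_closed(3) by (simp add: poly_ring_def)
    then show "\<exists>y \<in> carrier (poly_ring V). y \<oplus>\<^bsub>poly_ring V\<^esub> x = \<zero>\<^bsub>poly_ring V\<^esub>"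
      by (intro bexI[of _ "- x"]) (simp_all add: poly_ring_def)
  qed (simp_all add: poly_ring_def zero polys_closed ac_simps)
  show "comm_monoid (poly_ring V :: 'a mpoly ring)"
    by (rule comm_monoidI) (simp_all add: poly_ring_def one polys_closed ac_simps)
qed (simp add: poly_ring_def distrib_right)


section \<open>Minimal graded free resolutions and graded Betti numbers\<close>

definition free_module :: "nat set \<Rightarrow> nat \<Rightarrow> ('a::zero) mpoly vec set" where
  "free_module V r = {f \<in> carrier_vec r. \<forall>e < r. f $ e \<in> polys V}"

text \<open>
  Let \<open>R = \<bbbk>[x\<^sub>v | v \<in> V]\<close> and let \<open>J\<close> be a homogeneous ideal of \<open>R\<close>. The predicate
  \<open>minimal_graded_resolution V J s \<epsilon> D\<close> says that
  \<open>\<dots> \<rightarrow> F\<^sub>2 \<rightarrow> F\<^sub>1 \<rightarrow> F\<^sub>0 \<rightarrow> R/J \<rightarrow> 0\<close> is a minimal graded free resolution of the \<open>R\<close>-module \<open>R/J\<close>, where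

  \<^item> \<open>F\<^sub>i\<close> is the direct sum of the modules \<open>R(-a)\<close> for \<open>a\<close> in the list \<open>s i\<close>, so that
    the basis element number \<open>e\<close> of \<open>F\<^sub>i\<close> has degree \<open>s i ! e\<close>;

  \<^item> the map \<open>F\<^sub>0 \<rightarrow> R/J\<close> sends basis element \<open>e\<close> to the class of the polynomial \<open>\<epsilon> $ e\<close>;

  \<^item> \<open>D i\<close> is the matrix of the differential \<open>F\<^sub>i\<^sub>+\<^sub>1 \<rightarrow> F\<^sub>i\<close>.

  The conditions say, in order, that these data are well formed and homogeneous of degree 0, that
  \<open>F\<^sub>0 \<rightarrow> R/J\<close> is surjective, that the sequence is exact at \<open>F\<^sub>0\<close> and at each \<open>F\<^sub>i\<^sub>+\<^sub>1\<close>, and that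
  each differential maps into the irrelevant ideal times its target.
\<close>

definition minimal_graded_resolution ::
  "nat set \<Rightarrow> ('a::field) mpoly set \<Rightarrow> (nat \<Rightarrow> int list) \<Rightarrow> 'a mpoly vec \<Rightarrow> (nat \<Rightarrow> 'a mpoly mat) \<Rightarrow> bool"
where
  "minimal_graded_resolution V J s \<epsilon> D \<longleftrightarrow>
    (let rk = (\<lambda>i. length (s i)) in
      \<epsilon> \<in> free_module V (rk 0) \<and>
      (\<forall>e < rk 0. homogeneous (s 0 ! e) (\<epsilon> $ e)) \<and>
      (\<forall>i. D i \<in> carrier_mat (rk i) (rk (Suc i))) \<and>
      (\<forall>i. \<forall>p < rk i. \<forall>q < rk (Suc i).
        D i $$ (p, q) \<in> polys V \<and> homogeneous (s (Suc i) ! q - s i ! p) (D i $$ (p, q))) \<and>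
      (\<forall>g \<in> polys V. \<exists>f \<in> free_module V (rk 0). g - \<epsilon> \<bullet> f \<in> J) \<and>
      {f \<in> free_module V (rk 0). \<epsilon> \<bullet> f \<in> J} = (\<lambda>f. D 0 *\<^sub>v f) ` free_module V (rk 1) \<and>
      (\<forall>i. {f \<in> free_module V (rk (Suc i)). D i *\<^sub>v f = 0\<^sub>v (rk i)} =
        (\<lambda>f. D (Suc i) *\<^sub>v f) ` free_module V (rk (Suc (Suc i)))) \<and>
      (\<forall>i. \<forall>p < rk i. \<forall>q < rk (Suc i). D i $$ (p, q) \<in> irrelevant_ideal V))"

text \<open>
  \<open>graded_betti V J i j\<close> is \<open>\<beta>\<^sub>i\<^sub>,\<^sub>j(R/J)\<close>, the number of summands \<open>R(-j)\<close> of \<open>F\<^sub>i\<close> in a minimal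
  graded free resolution of \<open>R/J\<close>.
\<close>

definition graded_betti :: "nat set \<Rightarrow> ('a::field) mpoly set \<Rightarrow> nat \<Rightarrow> int \<Rightarrow> nat" where
  "graded_betti V J i j =
    (THE b. \<exists>s \<epsilon> D. minimal_graded_resolution V J s \<epsilon> D \<and> b = count_list (s i) j)"


section \<open>Graphs and their Betti sequences\<close>

text \<open>A simple graph is a pair of its vertex set and its set of edges, which are 2-element sets.\<close>

type_synonym graph = "nat set \<times> nat set set"

abbreviation verts :: "graph \<Rightarrow> nat set" where "verts G \<equiv> fst G"
abbreviation edges :: "graph \<Rightarrow> nat set set" where "edges G \<equiv> snd G"

definition complement :: "graph \<Rightarrow> graph" where
  "complement G = (verts G, {{u, v} | u v. u \<in> verts G \<and> v \<in> verts G \<and> u \<noteq> v \<and> {u, v} \<notin> edges G})"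

definition nonedge_ideal :: "graph \<Rightarrow> ('a::comm_ring_1) mpoly set" where
  "nonedge_ideal G =
    Idl\<^bsub>poly_ring (verts G)\<^esub> {var u * var v | u v. u \<noteq> v \<and> {u, v} \<in> edges (complement G)}"

text \<open>The coefficient field of the polynomial ring is the type argument.\<close>

definition betti :: "'a::field itself \<Rightarrow> graph \<Rightarrow> nat \<Rightarrow> nat" where
  "betti _ G i = graded_betti (verts G) (nonedge_ideal G :: 'a mpoly set) i (int i + 1)"


section \<open>Threshold graphs\<close>

definition threshold_graph :: "nat \<Rightarrow> nat set \<Rightarrow> graph" where
  "threshold_graph n \<sigma> = ({0..n}, {{u, v} | u v. u < v \<and> v \<le> n \<and> v \<notin> \<sigma>})"

definition i_T :: "nat set \<Rightarrow> nat \<Rightarrow> nat" where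
  "i_T \<sigma> v = card {w \<in> \<sigma>. w > v}"

definition beta_label :: "nat set \<Rightarrow> nat \<Rightarrow> nat \<Rightarrow> nat set" where
  "beta_label \<sigma> u v = {u + 1 .. u + 1 + i_T \<sigma> v}"

text \<open>\<open>E\<^sup>\<beta>\<^sub>k\<close> of the complement, each edge \<open>{u, v}\<close> being given as the pair \<open>(u, v)\<close> with \<open>u < v\<close>.\<close>

definition beta_edges :: "nat \<Rightarrow> nat set \<Rightarrow> nat \<Rightarrow> (nat \<times> nat) set" where
  "beta_edges n \<sigma> k =
    {(u, v). u < v \<and> {u, v} \<in> edges (complement (threshold_graph n \<sigma>)) \<and> k \<in> beta_label \<sigma> u v}"

end

theory Submission
  imports Defs "Jordan_Normal_Form.Determinant"
begin

text \<open>
  Graded Betti numbers are well defined because the identity of \<open>R/J\<close> lifts to chain maps between any two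
  minimal resolutions, whose compositions are homotopic to the identity; since all differentials have entries
  in the irrelevant ideal, the constant terms of these chain maps are mutually inverse matrices over the field, and
  homogeneity makes them respect degrees.

  A minimal resolution of \<open>\<bbbk>[T]\<close> comes from linear quotients. Add the generators \<open>x\<^sub>u x\<^sub>v\<close> (\<open>u < v\<close>,
  \<open>v \<in> \<sigma>\<close>) with \<open>v\<close> decreasing and, for fixed \<open>v\<close>, with \<open>u\<close> increasing. The colon ideal of \<open>x\<^sub>u x\<^sub>v\<close> modulo the
  earlier generators is generated by the variables \<open>x\<^sub>w\<close> with \<open>w \<in> \<sigma>\<close>, \<open>w > v\<close>, and \<open>x\<^sub>a\<close> with \<open>a < u\<close>. The mapping
  cone of a lift of multiplication by \<open>x\<^sub>u x\<^sub>v\<close> from the Koszul resolution of this colon ideal is minimal for degree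
  reasons, so \<open>x\<^sub>u x\<^sub>v\<close> contributes \<open>u + i\<^sub>T(v)\<close> choose \<open>k - 1\<close> to \<open>\<beta>\<^sub>k\<close>. Summed over \<open>u\<close>, this agrees with the
  stated formula by the hockey-stick and Vandermonde identities. The Koszul resolution itself is an iterated
  mapping cone.
\<close>

section \<open>Polynomials and monomial ideals\<close>

lemma polys_mono_keys:
  "Poly_Mapping.keys p \<subseteq> Poly_Mapping.keys q \<Longrightarrow> q \<in> polys V \<Longrightarrow> p \<in> polys V"
  by (auto simp: polys_def)

lemma polys_0 [simp]: "0 \<in> polys V"
  by (simp add: polys_def)

lemma polys_1 [simp]: "(1 :: 'a::comm_ring_1 mpoly) \<in> polys V"
  by (simp add: polys_def)

lemma polys_uminus: "p \<in> polys V \<Longrightarrow> (- p :: 'a::comm_ring_1 mpoly) \<in> polys V"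
  using polys_closed(3) by blast

lemma polys_diff:
  "p \<in> polys V \<Longrightarrow> q \<in> polys V \<Longrightarrow> (p - q :: 'a::comm_ring_1 mpoly) \<in> polys V"
  using polys_closed(1)[of p V "- q"] polys_uminus[of q V] by simp

lemma polys_sum:
  "(\<And>x. x \<in> A \<Longrightarrow> f x \<in> polys V) \<Longrightarrow> (\<Sum>x\<in>A. f x :: 'a::comm_ring_1 mpoly) \<in> polys V"
  by (induction A rule: infinite_finite_induct) (auto intro: polys_closed)

lemma polys_single:
  "Poly_Mapping.keys m \<subseteq> V \<Longrightarrow> Poly_Mapping.single m c \<in> polys V"
  by (auto simp: polys_def)

text \<open>Natural exponents cannot cancel, so the support of a product of monomials is exactly the
  union of the supports.\<close>

lemma keys_add_nat:
  "Poly_Mapping.keys (m + m' :: nat \<Rightarrow>\<^sub>0 nat) = Poly_Mapping.keys m \<union> Poly_Mapping.keys m'"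
  by (auto simp: in_keys_iff lookup_add)

section \<open>Degree and homogeneity\<close>

lemma mon_degree_superset:
  "finite A \<Longrightarrow> Poly_Mapping.keys m \<subseteq> A \<Longrightarrow> mon_degree m = (\<Sum>v\<in>A. Poly_Mapping.lookup m v)"
  unfolding mon_degree_def by (rule sum.mono_neutral_left) (auto simp: in_keys_iff)

lemma mon_degree_add: "mon_degree (m + m') = mon_degree m + mon_degree m'"
proof -
  let ?A = "Poly_Mapping.keys m \<union> Poly_Mapping.keys m'"
  have "mon_degree (m + m') = (\<Sum>v\<in>?A. Poly_Mapping.lookup (m + m') v)"
    by (rule mon_degree_superset) (auto simp: keys_add_nat)
  then show ?thesis
    by (simp add: lookup_add sum.distrib mon_degree_superset[of ?A m] mon_degree_superset[of ?A m'])
qed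

lemma mon_degree_0 [simp]: "mon_degree 0 = 0"
  by (simp add: mon_degree_def)

lemma homogeneous_0 [simp]: "homogeneous d 0"
  by (simp add: homogeneous_def)

lemma homogeneous_1: "homogeneous 0 (1 :: 'a::comm_ring_1 mpoly)"
  by (simp add: homogeneous_def)

lemma homogeneous_add:
  "homogeneous d p \<Longrightarrow> homogeneous d q \<Longrightarrow> homogeneous d (p + q)"
  using Poly_Mapping.keys_add[of p q] unfolding homogeneous_def by blast

lemma homogeneous_uminus:
  "homogeneous d p \<Longrightarrow> homogeneous d (- p :: 'a::comm_ring_1 mpoly)"
  unfolding homogeneous_def by (simp add: in_keys_iff)

lemma homogeneous_mult:
  "homogeneous d p \<Longrightarrow> homogeneous e q \<Longrightarrow> homogeneous (d + e) (p * q :: 'a::comm_ring_1 mpoly)"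
  using keys_mult[of p q] unfolding homogeneous_def by (fastforce simp: mon_degree_add)

lemma homogeneous_sum:
  "(\<And>x. x \<in> A \<Longrightarrow> homogeneous d (f x)) \<Longrightarrow> homogeneous d (\<Sum>x\<in>A. f x :: 'a::comm_ring_1 mpoly)"
  by (induction A rule: infinite_finite_induct) (auto intro: homogeneous_add)

lemma sum_monomials:
  "(\<Sum>m\<in>Poly_Mapping.keys p. Poly_Mapping.single m (Poly_Mapping.lookup p m)) = p"
  by (rule poly_mapping_eqI)
    (auto simp: lookup_sum lookup_single when_def in_keys_iff)

section \<open>Selecting monomials and homogeneous components\<close>

text \<open>Serves two purposes: extracting homogeneous components, and splitting a polynomial into
  the part inside a monomial ideal and the rest.\<close>

definition restrict_mons :: "((nat \<Rightarrow>\<^sub>0 nat) \<Rightarrow> bool) \<Rightarrow> ('a::zero) mpoly \<Rightarrow> 'a mpoly" where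
  "restrict_mons P p = Poly_Mapping.mapp (\<lambda>m c. c when P m) p"

lemma lookup_restrict_mons:
  "Poly_Mapping.lookup (restrict_mons P p) m = (Poly_Mapping.lookup p m when P m)"
  by (simp add: restrict_mons_def lookup_mapp when_def in_keys_iff)

lemma keys_restrict_mons:
  "Poly_Mapping.keys (restrict_mons P p) = {m \<in> Poly_Mapping.keys p. P m}"
  by (auto simp: in_keys_iff lookup_restrict_mons)

lemma restrict_mons_polys: "p \<in> polys V \<Longrightarrow> restrict_mons P p \<in> polys V"
  by (rule polys_mono_keys) (auto simp: keys_restrict_mons)

lemma restrict_mons_split:
  "p = restrict_mons P p + restrict_mons (\<lambda>m. \<not> P m) (p :: 'a::comm_ring_1 mpoly)"
  by (rule poly_mapping_eqI) (simp add: lookup_add lookup_restrict_mons when_def)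

lemma restrict_mons_sum:
  "restrict_mons P (\<Sum>x\<in>A. f x) = (\<Sum>x\<in>A. restrict_mons P (f x :: 'a::comm_ring_1 mpoly))"
  by (rule poly_mapping_eqI) (simp add: lookup_sum lookup_restrict_mons when_def)

lemma restrict_mons_diff:
  "restrict_mons P (p - q) = restrict_mons P p - restrict_mons P (q :: 'a::comm_ring_1 mpoly)"
  by (rule poly_mapping_eqI) (simp add: lookup_minus lookup_restrict_mons when_def)

definition hom_part :: "int \<Rightarrow> ('a::zero) mpoly \<Rightarrow> 'a mpoly" where
  "hom_part d = restrict_mons (\<lambda>m. int (mon_degree m) = d)"

lemma homogeneous_hom_part: "homogeneous d (hom_part d p)"
  by (simp add: homogeneous_def hom_part_def keys_restrict_mons)

lemma hom_part_polys: "p \<in> polys V \<Longrightarrow> hom_part d p \<in> polys V"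
  by (simp add: hom_part_def restrict_mons_polys)

lemma hom_part_eq:
  fixes p q :: "'a::comm_ring_1 mpoly"
  assumes "homogeneous d p" and "\<forall>m \<in> Poly_Mapping.keys q. int (mon_degree m) \<noteq> d"
  shows "hom_part d (p + q) = p"
proof (rule poly_mapping_eqI)
  fix m
  show "Poly_Mapping.lookup (hom_part d (p + q)) m = Poly_Mapping.lookup p m"
  proof (cases "int (mon_degree m) = d")
    case True
    with assms(2) have "m \<notin> Poly_Mapping.keys q" by blast
    with True show ?thesis
      by (simp add: hom_part_def lookup_restrict_mons lookup_add in_keys_iff)
  next
    case False
    with assms(1) have "m \<notin> Poly_Mapping.keys p" by (auto simp: homogeneous_def)
    with False show ?thesis
      by (simp add: hom_part_def lookup_restrict_mons in_keys_iff)
  qed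
qed

lemma hom_part_homogeneous:
  "homogeneous d p \<Longrightarrow> hom_part d (p :: 'a::comm_ring_1 mpoly) = p"
  using hom_part_eq[of d p 0] by simp

text \<open>Split \<open>q\<close> into its component of degree \<open>e\<close> and the rest.
  Degrees add and \<open>p\<close> is homogeneous, so the rest contributes nothing in degree
  \<open>d + e\<close>.\<close>

lemma hom_part_mult:
  fixes p q :: "'a::comm_ring_1 mpoly"
  assumes "homogeneous d p"
  shows "hom_part (d + e) (p * q) = p * hom_part e q"
proof -
  let ?r = "restrict_mons (\<lambda>m. int (mon_degree m) \<noteq> e) q"
  have "p * q = p * hom_part e q + p * ?r"
    unfolding hom_part_def distrib_left[symmetric]
    by (subst restrict_mons_split[of q "\<lambda>m. int (mon_degree m) = e"]) simp
  moreover have "homogeneous (d + e) (p * hom_part e q)"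
    by (rule homogeneous_mult[OF assms homogeneous_hom_part])
  moreover have "\<forall>m \<in> Poly_Mapping.keys (p * ?r). int (mon_degree m) \<noteq> d + e"
    using keys_mult[of p ?r] assms unfolding homogeneous_def
    by (fastforce simp: mon_degree_add keys_restrict_mons)
  ultimately show ?thesis
    using hom_part_eq by simp
qed

section \<open>The constant term as a ring homomorphism\<close>

definition const_term :: "('a::zero) mpoly \<Rightarrow> 'a" where
  "const_term p = Poly_Mapping.lookup p 0"

lemma add_eq_0_pm_nat: "(m + m' :: nat \<Rightarrow>\<^sub>0 nat) = 0 \<longleftrightarrow> m = 0 \<and> m' = 0"
  by (auto simp: poly_mapping_eq_iff fun_eq_iff lookup_add)

text \<open>The zero exponent splits only as \<open>0 + 0\<close>, so one term of the convolution
  survives. Thus \<open>const_term\<close> realizes reduction modulo the irrelevant ideal.\<close>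

lemma const_term_mult:
  "const_term (p * q) = const_term p * const_term (q :: 'a::comm_ring_1 mpoly)"
proof -
  have "(\<Sum>q'. Poly_Mapping.lookup q q' when 0 = l + q') = (Poly_Mapping.lookup q 0 when l = 0)" for l
  proof (cases "l = 0")
    case False
    then have "0 \<noteq> l + q'" for q' using add_eq_0_pm_nat[of l q'] by metis
    with False show ?thesis by simp
  qed simp
  then show ?thesis
    by (simp add: const_term_def lookup_mult mult_when)
qed

lemma const_term_add: "const_term (p + q) = const_term p + const_term q"
  by (simp add: const_term_def lookup_add)

lemma const_term_diff: "const_term (p - q :: 'a::comm_ring_1 mpoly) = const_term p - const_term q"
  by (simp add: const_term_def lookup_minus)

lemma const_term_sum: "const_term (\<Sum>x\<in>A. f x) = (\<Sum>x\<in>A. const_term (f x))"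
  by (simp add: const_term_def lookup_sum)

lemma const_term_0 [simp]: "const_term 0 = 0"
  by (simp add: const_term_def)

lemma const_term_1 [simp]: "const_term (1 :: 'a::comm_ring_1 mpoly) = 1"
  by (simp add: const_term_def)

lemma const_term_homogeneous: "homogeneous d p \<Longrightarrow> d \<noteq> 0 \<Longrightarrow> const_term p = 0"
  by (force simp: const_term_def homogeneous_def in_keys_iff)

section \<open>Ideals of the polynomial ring and generated ideals\<close>

text \<open>Translates the ideal axioms of \<open>poly_ring V\<close> into type-class arithmetic;
  closure under negation comes from multiplying by \<open>- 1\<close>.\<close>

lemma ideal_poly_ringI:
  fixes I :: "'a::comm_ring_1 mpoly set"
  assumes sub: "I \<subseteq> polys V" and "0 \<in> I"
    and add: "\<And>p q. p \<in> I \<Longrightarrow> q \<in> I \<Longrightarrow> p + q \<in> I"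
    and mult: "\<And>p q. p \<in> I \<Longrightarrow> q \<in> polys V \<Longrightarrow> q * p \<in> I"
  shows "ideal I (poly_ring V)"
proof -
  interpret R: cring "poly_ring V :: 'a mpoly ring" by (rule cring_poly_ring)
  show ?thesis
  proof (rule idealI[OF R.ring_axioms])
    show "subgroup I (add_monoid (poly_ring V))"
    proof (rule R.add.subgroupI)
      show "I \<subseteq> carrier (poly_ring V)" using sub by (simp add: poly_ring_def)
      show "I \<noteq> {}" using assms(2) by blast
      fix a assume a: "a \<in> I"
      then have "(- 1) * a \<in> I"
        by (rule mult) (rule polys_uminus[OF polys_1])
      moreover have "\<ominus>\<^bsub>poly_ring V\<^esub> a = - a"
        using a sub by (intro R.minus_equality) (auto simp: poly_ring_def intro: polys_closed)
      ultimately show "\<ominus>\<^bsub>poly_ring V\<^esub> a \<in> I" by simp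
    qed (use add in \<open>simp add: poly_ring_def\<close>)
    fix a x :: "'a mpoly" assume "a \<in> I" "x \<in> carrier (poly_ring V)"
    then have "x * a \<in> I" by (simp add: mult poly_ring_def)
    then show "x \<otimes>\<^bsub>poly_ring V\<^esub> a \<in> I" "a \<otimes>\<^bsub>poly_ring V\<^esub> x \<in> I"
      by (simp_all add: poly_ring_def mult.commute)
  qed
qed

lemma ideal_poly_ringD:
  fixes I :: "'a::comm_ring_1 mpoly set"
  assumes "ideal I (poly_ring V)"
  shows "0 \<in> I" and "p \<in> I \<Longrightarrow> q \<in> I \<Longrightarrow> p + q \<in> I" and "p \<in> I \<Longrightarrow> q \<in> polys V \<Longrightarrow> q * p \<in> I"
    and "I \<subseteq> polys V"
  using additive_subgroup.zero_closed[OF ideal.axioms(1)[OF assms]]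
    additive_subgroup.a_closed[OF ideal.axioms(1)[OF assms]]
    additive_subgroup.a_subset[OF ideal.axioms(1)[OF assms]]
    ideal.I_l_closed[OF assms]
  by (auto simp: poly_ring_def)

lemma ideal_poly_ring_diff:
  fixes I :: "'a::comm_ring_1 mpoly set"
  assumes "ideal I (poly_ring V)" and "p \<in> I" "q \<in> I"
  shows "p - q \<in> I"
  using ideal_poly_ringD(2)[OF assms(1,2), of "(- 1) * q"]
    ideal_poly_ringD(3)[OF assms(1,3), of "- 1"]
  by (simp add: polys_uminus)

lemma ideal_poly_ring_sum:
  fixes I :: "'a::comm_ring_1 mpoly set"
  assumes "ideal I (poly_ring V)" and "\<And>x. x \<in> A \<Longrightarrow> f x \<in> I"
  shows "(\<Sum>x\<in>A. f x) \<in> I"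
  using assms(2)
  by (induction A rule: infinite_finite_induct) (auto intro: ideal_poly_ringD(1,2)[OF assms(1)])

lemma genideal_poly_ring:
  fixes S :: "'a::comm_ring_1 mpoly set"
  assumes "S \<subseteq> polys V"
  shows "ideal (Idl\<^bsub>poly_ring V\<^esub> S) (poly_ring V)" and "S \<subseteq> Idl\<^bsub>poly_ring V\<^esub> S"
    and "ideal I (poly_ring V) \<Longrightarrow> S \<subseteq> I \<Longrightarrow> Idl\<^bsub>poly_ring V\<^esub> S \<subseteq> I"
proof -
  interpret R: cring "poly_ring V :: 'a mpoly ring" by (rule cring_poly_ring)
  have S: "S \<subseteq> carrier (poly_ring V)" using assms by (simp add: poly_ring_def)
  show "ideal (Idl\<^bsub>poly_ring V\<^esub> S) (poly_ring V)" by (rule R.genideal_ideal[OF S])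
  show "S \<subseteq> Idl\<^bsub>poly_ring V\<^esub> S" by (rule R.genideal_self[OF S])
  show "ideal I (poly_ring V) \<Longrightarrow> S \<subseteq> I \<Longrightarrow> Idl\<^bsub>poly_ring V\<^esub> S \<subseteq> I" by (rule R.genideal_minimal)
qed

text \<open>A polynomial is the sum of its terms, and each term is a multiple of a monomial of the
  ideal. This is how generated ideals are shown to contain ideals described by supports.\<close>

lemma ideal_containing_monomials:
  fixes p :: "'a::comm_ring_1 mpoly"
  assumes I: "ideal I (poly_ring V)" and "p \<in> polys V"
    and "\<And>m. m \<in> Poly_Mapping.keys p \<Longrightarrow> \<exists>l. Poly_Mapping.single l 1 \<in> I \<and> (\<exists>r. m = r + l)"
  shows "p \<in> I"
proof -
  have "Poly_Mapping.single m (Poly_Mapping.lookup p m) \<in> I" if m: "m \<in> Poly_Mapping.keys p" for m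
  proof -
    obtain l r where l: "Poly_Mapping.single l 1 \<in> I" and r: "m = r + l"
      using assms(3)[OF m] by blast
    \<comment> \<open>The cofactor stays in the variables \<open>V\<close> because the support of
      \<open>r\<close> is contained in that of \<open>m\<close>.\<close>
    have "Poly_Mapping.single r (Poly_Mapping.lookup p m) \<in> polys V"
      using m assms(2) keys_add_nat[of r l] r by (intro polys_single) (auto simp: polys_def)
    from ideal_poly_ringD(3)[OF I l this] show ?thesis
      by (simp add: mult_single r)
  qed
  then show ?thesis
    using ideal_poly_ring_sum[OF I] sum_monomials[of p] by metis
qed

section \<open>Variables, squarefree monomials and the irrelevant ideal\<close>

lemma var_polys: "v \<in> V \<Longrightarrow> (var v :: 'a::comm_ring_1 mpoly) \<in> polys V"
  unfolding var_def by (rule polys_single) simp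

text \<open>The indicator function of a finite \<open>S\<close>, as an exponent. For infinite
  \<open>S\<close> the sum takes its default value 0, whence the finiteness hypotheses
  below.\<close>

definition sqfree_exp :: "nat set \<Rightarrow> (nat \<Rightarrow>\<^sub>0 nat)" where
  "sqfree_exp S = (\<Sum>v\<in>S. Poly_Mapping.single v 1)"

lemma lookup_sqfree_exp:
  "finite S \<Longrightarrow> Poly_Mapping.lookup (sqfree_exp S) v = (if v \<in> S then 1 else 0)"
  by (simp add: sqfree_exp_def lookup_sum lookup_single when_def)

lemma keys_sqfree_exp: "finite S \<Longrightarrow> Poly_Mapping.keys (sqfree_exp S) = S"
  by (auto simp: in_keys_iff lookup_sqfree_exp split: if_splits)

text \<open>The witness is \<open>m - sqfree_exp S\<close>: subtraction of exponents is truncated,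
  but exact here because every exponent on \<open>S\<close> is positive.\<close>

lemma split_monomial:
  assumes "finite S" and "S \<subseteq> Poly_Mapping.keys (m :: nat \<Rightarrow>\<^sub>0 nat)"
  shows "\<exists>r. m = r + sqfree_exp S"
proof -
  have "m = (m - sqfree_exp S) + sqfree_exp S"
  proof (rule poly_mapping_eqI)
    fix v
    have "v \<in> S \<Longrightarrow> Poly_Mapping.lookup m v > 0"
      using assms(2) by (auto simp: in_keys_iff)
    then show "Poly_Mapping.lookup m v =
      Poly_Mapping.lookup ((m - sqfree_exp S) + sqfree_exp S) v"
      using assms(1) by (auto simp: lookup_add lookup_minus lookup_sqfree_exp)
  qed
  then show ?thesis by blast
qed

text \<open>The polynomials over \<open>V\<close> without constant term form an ideal containing the
  variables; conversely, each of their monomials is divisible by a variable of \<open>V\<close>.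
  Minimality of a resolution thereby becomes a condition on constant terms.\<close>

lemma mem_irrelevant_ideal:
  fixes p :: "'a::comm_ring_1 mpoly"
  shows "p \<in> irrelevant_ideal V \<longleftrightarrow> p \<in> polys V \<and> const_term p = 0"
proof
  have sub: "(var ` V :: 'a mpoly set) \<subseteq> polys V" using var_polys by blast
  have "ideal {p :: 'a mpoly. p \<in> polys V \<and> const_term p = 0} (poly_ring V)"
    by (rule ideal_poly_ringI) (auto simp: const_term_mult const_term_add polys_closed)
  then have "irrelevant_ideal V \<subseteq> {p :: 'a mpoly. p \<in> polys V \<and> const_term p = 0}"
    unfolding irrelevant_ideal_def using sub
    by (intro genideal_poly_ring(3)) (auto simp: const_term_def var_def lookup_single when_def
        poly_mapping_eq_iff fun_eq_iff)
  then show "p \<in> irrelevant_ideal V \<Longrightarrow> p \<in> polys V \<and> const_term p = 0" by blast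
  assume p: "p \<in> polys V \<and> const_term p = 0"
  show "p \<in> irrelevant_ideal V"
    unfolding irrelevant_ideal_def
  proof (rule ideal_containing_monomials[OF genideal_poly_ring(1)[OF sub]])
    show "p \<in> polys V" using p by blast
    fix m assume m: "m \<in> Poly_Mapping.keys p"
    then have "m \<noteq> 0" using p by (auto simp: const_term_def in_keys_iff)
    then obtain v where v: "v \<in> Poly_Mapping.keys m" by (auto simp: poly_mapping_eq_iff fun_eq_iff in_keys_iff)
    then have "v \<in> V" using p m by (auto simp: polys_def)
    then have "(var v :: 'a mpoly) \<in> Idl\<^bsub>poly_ring V\<^esub> (var ` V)"
      using genideal_poly_ring(2)[OF sub] by blast
    moreover obtain r where "m = r + Poly_Mapping.single v 1"
      using split_monomial[of "{v}" m] v by (auto simp: sqfree_exp_def)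
    ultimately show "\<exists>l. (Poly_Mapping.single l 1 :: 'a mpoly) \<in> Idl\<^bsub>poly_ring V\<^esub> (var ` V) \<and> (\<exists>r. m = r + l)"
      unfolding var_def by blast
  qed
qed

section \<open>Ideals given by conditions on supports: colon and adding a generator\<close>

definition up_closed :: "('b set \<Rightarrow> bool) \<Rightarrow> bool" where
  "up_closed K \<longleftrightarrow> (\<forall>X Y. X \<subseteq> Y \<longrightarrow> K X \<longrightarrow> K Y)"

text \<open>Squarefree monomial ideals, given by the set of supports of their monomials.\<close>

definition mon_ideal :: "nat set \<Rightarrow> (nat set \<Rightarrow> bool) \<Rightarrow> ('a::zero) mpoly set" where
  "mon_ideal V K = {p \<in> polys V. \<forall>m \<in> Poly_Mapping.keys p. K (Poly_Mapping.keys m)}"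

text \<open>Multiplication by a monomial only enlarges supports, so an up-closed condition on
  supports survives it.\<close>

lemma ideal_mon_ideal:
  assumes "up_closed K"
  shows "ideal (mon_ideal V K :: 'a::comm_ring_1 mpoly set) (poly_ring V)"
proof (rule ideal_poly_ringI)
  fix p q :: "'a mpoly"
  assume p: "p \<in> mon_ideal V K"
  { assume "q \<in> mon_ideal V K"
    then show "p + q \<in> mon_ideal V K"
      using p Poly_Mapping.keys_add[of p q] by (auto simp: mon_ideal_def polys_closed) }
  { assume q: "q \<in> polys V"
    have "K (Poly_Mapping.keys m)" if "m \<in> Poly_Mapping.keys (q * p)" for m
    proof -
      have "m \<in> {a + b | a b. a \<in> Poly_Mapping.keys q \<and> b \<in> Poly_Mapping.keys p}"
        using keys_mult that by (rule subsetD)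
      then obtain a b where "m = a + b" "b \<in> Poly_Mapping.keys p" by blast
      then show ?thesis
        using p assms unfolding up_closed_def mon_ideal_def keys_add_nat
        by (metis (no_types, lifting) Un_upper2 keys_add_nat mem_Collect_eq)
    qed
    then show "q * p \<in> mon_ideal V K"
      using p q by (auto simp: mon_ideal_def polys_closed) }
qed (auto simp: mon_ideal_def)

lemma mon_ideal_restrict: "p \<in> mon_ideal V K \<Longrightarrow> restrict_mons P p \<in> mon_ideal V K"
  by (auto simp: mon_ideal_def restrict_mons_polys keys_restrict_mons)

lemma mon_ideal_hom_part: "p \<in> mon_ideal V K \<Longrightarrow> hom_part d p \<in> mon_ideal V K"
  by (simp add: hom_part_def mon_ideal_restrict)

definition sqfree_mon :: "nat set \<Rightarrow> ('a::zero_neq_one) mpoly" where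
  "sqfree_mon S = Poly_Mapping.single (sqfree_exp S) 1"

lemma sqfree_mon_polys: "finite S \<Longrightarrow> S \<subseteq> V \<Longrightarrow> sqfree_mon S \<in> polys V"
  unfolding sqfree_mon_def by (rule polys_single) (simp add: keys_sqfree_exp)

lemma homogeneous_sqfree_mon: "finite S \<Longrightarrow> homogeneous (int (card S)) (sqfree_mon S)"
  by (simp add: homogeneous_def sqfree_mon_def mon_degree_def keys_sqfree_exp lookup_sqfree_exp)

lemma lookup_sqfree_mon_mult:
  "Poly_Mapping.lookup (sqfree_mon S * p) (sqfree_exp S + m) =
    Poly_Mapping.lookup (p :: 'a::comm_ring_1 mpoly) m"
  by (simp add: sqfree_mon_def lookup_mult lookup_single when_mult)

text \<open>Multiplication by a monomial translates exponents injectively, so no terms merge or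
  cancel.\<close>

lemma keys_sqfree_mon_mult:
  "Poly_Mapping.keys (sqfree_mon S * (p :: 'a::comm_ring_1 mpoly)) =
    (+) (sqfree_exp S) ` Poly_Mapping.keys p"
proof
  show "Poly_Mapping.keys (sqfree_mon S * p) \<subseteq> (+) (sqfree_exp S) ` Poly_Mapping.keys p"
    using keys_mult[of "sqfree_mon S" p] by (auto simp: sqfree_mon_def)
  show "(+) (sqfree_exp S) ` Poly_Mapping.keys p \<subseteq> Poly_Mapping.keys (sqfree_mon S * p)"
    by (auto simp: in_keys_iff lookup_sqfree_mon_mult)
qed

text \<open>Every support gets \<open>S\<close> added to it, so the colon ideal by a squarefree
  monomial is again given by a condition on supports.\<close>

lemma mon_ideal_colon:
  fixes p :: "'a::comm_ring_1 mpoly"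
  assumes "finite S" "S \<subseteq> V" "p \<in> polys V"
  shows "sqfree_mon S * p \<in> mon_ideal V K \<longleftrightarrow> p \<in> mon_ideal V (\<lambda>X. K (S \<union> X))"
  using assms polys_closed(2)[OF sqfree_mon_polys[OF assms(1,2)] assms(3)]
  by (auto simp: mon_ideal_def keys_sqfree_mon_mult keys_add_nat keys_sqfree_exp)

text \<open>The right-hand side says that \<open>p\<close> lies in the ideal plus the principal
  ideal of \<open>sqfree_mon S\<close>. The terms of \<open>p\<close> whose support violates
  \<open>K\<close> all have support containing \<open>S\<close>, so together they form a multiple of
  that monomial, and the remaining terms lie in the old ideal.\<close>

lemma mon_ideal_insert:
  fixes p :: "'a::comm_ring_1 mpoly"
  assumes S: "finite S" "S \<subseteq> V" and K: "up_closed K" and p: "p \<in> polys V"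
  shows "p \<in> mon_ideal V (\<lambda>X. K X \<or> S \<subseteq> X) \<longleftrightarrow> (\<exists>r \<in> polys V. p - sqfree_mon S * r \<in> mon_ideal V K)"
proof
  assume mem: "p \<in> mon_ideal V (\<lambda>X. K X \<or> S \<subseteq> X)"
  let ?P = "\<lambda>m. K (Poly_Mapping.keys m)"
  \<comment> \<open>The principal ideal, written as an explicit set of multiples so that membership
    yields the cofactor \<open>r\<close>.\<close>
  let ?I = "{sqfree_mon S * r | r :: 'a mpoly. r \<in> polys V}"
  have "ideal ?I (poly_ring V)"
  proof (rule ideal_poly_ringI)
    show "?I \<subseteq> polys V" using polys_closed(2)[OF sqfree_mon_polys[OF S]] by blast
    show "0 \<in> ?I" by (auto intro!: exI[of _ 0])
    show "a + b \<in> ?I" if "a \<in> ?I" "b \<in> ?I" for a b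
    proof -
      from that obtain r s where "a = sqfree_mon S * r" "b = sqfree_mon S * s" "r \<in> polys V" "s \<in> polys V"
        by blast
      then show ?thesis
        by (intro CollectI exI[of _ "r + s"]) (simp add: distrib_left polys_closed)
    qed
    show "b * a \<in> ?I" if "a \<in> ?I" "b \<in> polys V" for a b
    proof -
      from that obtain r where "a = sqfree_mon S * r" "r \<in> polys V" by blast
      with that show ?thesis
        by (intro CollectI exI[of _ "b * r"]) (simp add: mult.left_commute polys_closed)
    qed
  qed
  then have "restrict_mons (\<lambda>m. \<not> ?P m) p \<in> ?I"
  proof (rule ideal_containing_monomials)
    show "restrict_mons (\<lambda>m. \<not> ?P m) p \<in> polys V" using p by (rule restrict_mons_polys)
    fix m assume "m \<in> Poly_Mapping.keys (restrict_mons (\<lambda>m. \<not> ?P m) p)"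
    then have "S \<subseteq> Poly_Mapping.keys m"
      using mem by (auto simp: mon_ideal_def keys_restrict_mons)
    then obtain r where "m = r + sqfree_exp S"
      using split_monomial[OF S(1)] by blast
    moreover have "sqfree_mon S \<in> ?I" by (auto intro!: exI[of _ 1])
    ultimately show "\<exists>l. Poly_Mapping.single l 1 \<in> ?I \<and> (\<exists>r. m = r + l)"
      unfolding sqfree_mon_def by blast
  qed
  then obtain r where r: "r \<in> polys V" and eq: "restrict_mons (\<lambda>m. \<not> ?P m) p = sqfree_mon S * r" by blast
  have "p - sqfree_mon S * r = restrict_mons ?P p"
    using restrict_mons_split[of p ?P] eq by (metis add_diff_cancel_right')
  moreover have "restrict_mons ?P p \<in> mon_ideal V K"
    using p by (auto simp: mon_ideal_def restrict_mons_polys keys_restrict_mons)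
  ultimately show "\<exists>r \<in> polys V. p - sqfree_mon S * r \<in> mon_ideal V K" using r by metis
next
  assume "\<exists>r \<in> polys V. p - sqfree_mon S * r \<in> mon_ideal V K"
  then obtain r where r: "r \<in> polys V" "p - sqfree_mon S * r \<in> mon_ideal V K" by blast
  have up: "up_closed (\<lambda>X. K X \<or> S \<subseteq> X)" using K unfolding up_closed_def by blast
  have "p - sqfree_mon S * r \<in> mon_ideal V (\<lambda>X. K X \<or> S \<subseteq> X)"
    using r(2) by (auto simp: mon_ideal_def)
  moreover have "sqfree_mon S * r \<in> mon_ideal V (\<lambda>X. K X \<or> S \<subseteq> X)"
    using r(1) S by (subst mon_ideal_colon) (auto simp: mon_ideal_def)
  ultimately show "p \<in> mon_ideal V (\<lambda>X. K X \<or> S \<subseteq> X)"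
    using ideal_poly_ringD(2)[OF ideal_mon_ideal[OF up]] by fastforce
qed


section \<open>Homogeneous matrices and graded resolutions\<close>

text \<open>A degree-preserving map from the direct sum of the \<open>R(- b ! q)\<close> to that of
  the \<open>R(- a ! p)\<close>. Where the degree difference is negative, the entry is forced to be
  zero.\<close>

definition hmat :: "nat set \<Rightarrow> int list \<Rightarrow> int list \<Rightarrow> ('a::zero) mpoly mat \<Rightarrow> bool" where
  "hmat V a b A \<longleftrightarrow> A \<in> carrier_mat (length a) (length b) \<and>
    (\<forall>p < length a. \<forall>q < length b. A $$ (p, q) \<in> polys V \<and> homogeneous (b ! q - a ! p) (A $$ (p, q)))"

lemma hmat_carrier: "hmat V a b A \<Longrightarrow> A \<in> carrier_mat (length a) (length b)"
  by (simp add: hmat_def)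

lemma hmat_dim: "hmat V a b A \<Longrightarrow> dim_row A = length a \<and> dim_col A = length b"
  by (auto simp: hmat_def)

lemma hmat_mult:
  fixes A B :: "'a::comm_ring_1 mpoly mat"
  assumes A: "hmat V a b A" and B: "hmat V b c B"
  shows "hmat V a c (A * B)"
  unfolding hmat_def
proof (intro conjI allI impI)
  show "A * B \<in> carrier_mat (length a) (length c)"
    using hmat_carrier[OF A] hmat_carrier[OF B] by simp
  fix p q assume pq: "p < length a" "q < length c"
  have eq: "(A * B) $$ (p, q) = (\<Sum>e = 0..<length b. A $$ (p, e) * B $$ (e, q))"
    using pq hmat_dim[OF A] hmat_dim[OF B] by (simp add: scalar_prod_def)
  show "(A * B) $$ (p, q) \<in> polys V"
    unfolding eq using A B pq by (intro polys_sum polys_closed) (auto simp: hmat_def)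
  show "homogeneous (c ! q - a ! p) ((A * B) $$ (p, q))"
    unfolding eq
  proof (rule homogeneous_sum)
    fix e assume "e \<in> {0..<length b}"
    then show "homogeneous (c ! q - a ! p) (A $$ (p, e) * B $$ (e, q))"
      using homogeneous_mult[of "b ! e - a ! p" "A $$ (p, e)" "c ! q - b ! e" "B $$ (e, q)"] A B pq
      by (simp add: hmat_def)
  qed
qed

lemma hmat_diff:
  fixes A B :: "'a::comm_ring_1 mpoly mat"
  assumes A: "hmat V a b A" and B: "hmat V a b B"
  shows "hmat V a b (A - B)"
  unfolding hmat_def
proof (intro conjI allI impI)
  show "A - B \<in> carrier_mat (length a) (length b)" using hmat_carrier[OF B] by (rule minus_carrier_mat)
  fix p q assume pq: "p < length a" "q < length b"
  then have eq: "(A - B) $$ (p, q) = A $$ (p, q) + - B $$ (p, q)"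
    using hmat_dim[OF B] by simp
  show "(A - B) $$ (p, q) \<in> polys V"
    unfolding eq using assms pq by (intro polys_closed(1) polys_uminus) (simp_all add: hmat_def)
  show "homogeneous (b ! q - a ! p) ((A - B) $$ (p, q))"
    unfolding eq using assms pq by (intro homogeneous_add homogeneous_uminus) (simp_all add: hmat_def)
qed

lemma hmat_one: "hmat V a a (1\<^sub>m (length a) :: 'a::comm_ring_1 mpoly mat)"
  by (auto simp: hmat_def homogeneous_1)

text \<open>Only differences of degrees enter, so twisting source and target alike changes
  nothing.\<close>

lemma hmat_shift:
  "hmat V (map ((+) d) a) (map ((+) d) b) A \<longleftrightarrow> hmat V a b A"
  by (simp add: hmat_def cong: conj_cong)

lemma free_module_carrier: "f \<in> free_module V r \<Longrightarrow> f \<in> carrier_vec r"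
  by (simp add: free_module_def)

lemma hmat_col: "hmat V a b A \<Longrightarrow> q < length b \<Longrightarrow> col A q \<in> free_module V (length a)"
  by (auto simp: hmat_def free_module_def)

lemma hmat_mult_vec:
  fixes A :: "'a::comm_ring_1 mpoly mat"
  assumes A: "hmat V a b A" and f: "f \<in> free_module V (length b)"
  shows "A *\<^sub>v f \<in> free_module V (length a)"
  using assms by (auto simp: hmat_def free_module_def scalar_prod_def intro!: polys_sum polys_closed)

lemma unit_vec_free_module: "(unit_vec r q :: 'a::comm_ring_1 mpoly vec) \<in> free_module V r"
  by (auto simp: free_module_def unit_vec_def)

lemma mult_mat_unit_vec:
  fixes A :: "'a::comm_ring_1 mat"
  assumes "A \<in> carrier_mat n m" "q < m"
  shows "A *\<^sub>v unit_vec m q = col A q"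
  using assms by (auto intro!: eq_vecI)

text \<open>A homogeneous lift is obtained from an arbitrary one by taking homogeneous components.\<close>

definition hom_cols :: "int list \<Rightarrow> int list \<Rightarrow> (nat \<Rightarrow> ('a::zero) mpoly vec) \<Rightarrow> 'a mpoly mat" where
  "hom_cols b c f = mat (length b) (length c) (\<lambda>(e, q). hom_part (c ! q - b ! e) (f q $ e))"

lemma hmat_hom_cols:
  "(\<And>q. q < length c \<Longrightarrow> f q \<in> free_module V (length b)) \<Longrightarrow> hmat V b c (hom_cols b c f)"
  by (auto simp: hmat_def hom_cols_def free_module_def intro: hom_part_polys homogeneous_hom_part)

text \<open>The degrees telescope: an entry of degree \<open>b ! e - a ! p\<close> times a component
  of degree \<open>c ! q - b ! e\<close> is a component of degree \<open>c ! q - a ! p\<close>, by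
  \<open>hom_part_mult\<close>.\<close>

lemma mult_hom_cols:
  fixes A :: "'a::comm_ring_1 mpoly mat"
  assumes A: "hmat V a b A" and f: "\<And>q. q < length c \<Longrightarrow> f q \<in> free_module V (length b)"
    and pq: "p < length a" "q < length c"
  shows "(A * hom_cols b c f) $$ (p, q) = hom_part (c ! q - a ! p) ((A *\<^sub>v f q) $ p)"
proof -
  have "(A * hom_cols b c f) $$ (p, q) =
      (\<Sum>e = 0..<length b. A $$ (p, e) * hom_part (c ! q - b ! e) (f q $ e))"
    using pq hmat_dim[OF A] by (simp add: scalar_prod_def hom_cols_def)
  also have "\<dots> = (\<Sum>e = 0..<length b. hom_part (c ! q - a ! p) (A $$ (p, e) * f q $ e))"
  proof (rule sum.cong[OF refl])
    fix e assume "e \<in> {0..<length b}"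
    then have "homogeneous (b ! e - a ! p) (A $$ (p, e))" using A pq by (simp add: hmat_def)
    from hom_part_mult[OF this, of "c ! q - b ! e"]
    show "A $$ (p, e) * hom_part (c ! q - b ! e) (f q $ e) = hom_part (c ! q - a ! p) (A $$ (p, e) * f q $ e)"
      by simp
  qed
  also have "\<dots> = hom_part (c ! q - a ! p) ((A *\<^sub>v f q) $ p)"
    using pq hmat_dim[OF A] free_module_carrier[OF f[OF pq(2)]]
    by (simp add: scalar_prod_def hom_part_def restrict_mons_sum)
  finally show ?thesis .
qed

text \<open>Choose preimages of the columns and apply \<open>hom_cols\<close>; the entries of
  \<open>A\<close> are homogeneous already and so equal their own components.\<close>

lemma hmat_lift:
  fixes A D :: "'a::comm_ring_1 mpoly mat"
  assumes D: "hmat V a b D" and A: "hmat V a c A"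
    and ex: "\<And>q. q < length c \<Longrightarrow> \<exists>f \<in> free_module V (length b). D *\<^sub>v f = col A q"
  shows "\<exists>B. hmat V b c B \<and> D * B = A"
proof -
  obtain f where f: "\<And>q. q < length c \<Longrightarrow> f q \<in> free_module V (length b)"
      and eq: "\<And>q. q < length c \<Longrightarrow> D *\<^sub>v f q = col A q"
    using ex by metis
  have "D * hom_cols b c f = A"
  proof (rule eq_matI)
    fix p q assume "p < dim_row A" "q < dim_col A"
    then have pq: "p < length a" "q < length c" using hmat_dim[OF A] by auto
    have "homogeneous (c ! q - a ! p) (A $$ (p, q))" using A pq by (simp add: hmat_def)
    then show "(D * hom_cols b c f) $$ (p, q) = A $$ (p, q)"
      using mult_hom_cols[OF D f pq] eq[OF pq(2)] pq hmat_dim[OF A] by (simp add: hom_part_homogeneous)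
  qed (use hmat_dim[OF A] hmat_dim[OF D] in \<open>auto simp: hom_cols_def\<close>)
  then show ?thesis using hmat_hom_cols[of c f V b] f by blast
qed

section \<open>Matrices with entries in an ideal\<close>

definition entries_in :: "'b set \<Rightarrow> 'b mat \<Rightarrow> bool" where
  "entries_in J A \<longleftrightarrow> (\<forall>i < dim_row A. \<forall>j < dim_col A. A $$ (i, j) \<in> J)"

lemma entries_in_diff:
  fixes A B :: "'a::comm_ring_1 mpoly mat"
  assumes "ideal J (poly_ring V)" and "A \<in> carrier_mat n m" "B \<in> carrier_mat n m"
    and "entries_in J A" "entries_in J B"
  shows "entries_in J (A - B)"
  using assms(2-) by (auto simp: entries_in_def intro: ideal_poly_ring_diff[OF assms(1)])

lemma entries_in_mult:
  fixes A B :: "'a::comm_ring_1 mpoly mat"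
  assumes "ideal J (poly_ring V)" and "A \<in> carrier_mat n (length b)" and B: "hmat V b c B" and "entries_in J A"
  shows "entries_in J (A * B)"
  unfolding entries_in_def
proof (intro allI impI)
  fix i j assume "i < dim_row (A * B)" "j < dim_col (A * B)"
  then have ij: "i < n" "j < length c" using assms(2) hmat_dim[OF B] by auto
  have "(A * B) $$ (i, j) = (\<Sum>e = 0..<length b. B $$ (e, j) * A $$ (i, e))"
    using ij assms(2) hmat_dim[OF B] by (simp add: scalar_prod_def mult.commute)
  also have "\<dots> \<in> J"
    using ij assms(2,4) B
    by (intro ideal_poly_ring_sum[OF assms(1)] ideal_poly_ringD(3)[OF assms(1)])
      (auto simp: hmat_def entries_in_def)
  finally show "(A * B) $$ (i, j) \<in> J" .
qed

text \<open>Turns the augmentation into a one-row matrix, so that the matrix lemmas apply to it; its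
  target \<open>R\<close> has the degree list \<open>[0]\<close>.\<close>

definition row_mat :: "'b vec \<Rightarrow> 'b mat" where
  "row_mat \<epsilon> = mat 1 (dim_vec \<epsilon>) (\<lambda>(_, j). \<epsilon> $ j)"

lemma row_mat_carrier: "\<epsilon> \<in> carrier_vec n \<Longrightarrow> row_mat \<epsilon> \<in> carrier_mat 1 n"
  by (auto simp: row_mat_def)

lemma row_row_mat: "row (row_mat \<epsilon>) 0 = \<epsilon>"
  by (auto simp: row_mat_def row_def)

section \<open>Graded resolutions, cycles and lifting\<close>

text \<open>\<open>minimal_graded_resolution\<close> without minimality, with the homogeneity
  conditions packed into \<open>hmat\<close>.\<close>

definition graded_resolution ::
  "nat set \<Rightarrow> ('a::comm_ring_1) mpoly set \<Rightarrow> (nat \<Rightarrow> int list) \<Rightarrow> 'a mpoly vec \<Rightarrow> (nat \<Rightarrow> 'a mpoly mat) \<Rightarrow> bool"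
where
  "graded_resolution V J s \<epsilon> D \<longleftrightarrow>
    \<epsilon> \<in> free_module V (length (s 0)) \<and> hmat V [0] (s 0) (row_mat \<epsilon>) \<and> (\<forall>i. hmat V (s i) (s (Suc i)) (D i)) \<and>
    (\<forall>g \<in> polys V. \<exists>f \<in> free_module V (length (s 0)). g - \<epsilon> \<bullet> f \<in> J) \<and>
    {f \<in> free_module V (length (s 0)). \<epsilon> \<bullet> f \<in> J} = (\<lambda>f. D 0 *\<^sub>v f) ` free_module V (length (s 1)) \<and>
    (\<forall>i. {f \<in> free_module V (length (s (Suc i))). D i *\<^sub>v f = 0\<^sub>v (length (s i))} =
        (\<lambda>f. D (Suc i) *\<^sub>v f) ` free_module V (length (s (Suc (Suc i)))))"

text \<open>By \<open>mem_irrelevant_ideal\<close>, minimality means that all entries of the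
  differentials have constant term zero.\<close>

lemma minimal_graded_resolution_iff:
  "minimal_graded_resolution V J s \<epsilon> D \<longleftrightarrow>
    graded_resolution V J s \<epsilon> D \<and>
    (\<forall>i. \<forall>p < length (s i). \<forall>q < length (s (Suc i)). const_term (D i $$ (p, q)) = 0)"
proof -
  have "hmat V [0] (s 0) (row_mat \<epsilon>) \<longleftrightarrow> (\<forall>e < length (s 0). homogeneous (s 0 ! e) (\<epsilon> $ e))"
    if "\<epsilon> \<in> free_module V (length (s 0))"
    using that by (auto simp: hmat_def row_mat_def free_module_def)
  then show ?thesis
    unfolding minimal_graded_resolution_def graded_resolution_def Let_def mem_irrelevant_ideal
    by (simp add: hmat_def[of V "s i" "s (Suc i)" "D i" for i] all_conj_distrib cong: conj_cong)
qed

text \<open>The columns of \<open>A\<close> are cycles in homological degree \<open>i\<close>, where \<open>F\<^sub>0\<close> is mapped to \<open>R/J\<close>.\<close>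

definition cycles ::
  "('a::comm_ring_1) mpoly set \<Rightarrow> 'a mpoly vec \<Rightarrow> (nat \<Rightarrow> 'a mpoly mat) \<Rightarrow> nat \<Rightarrow> 'a mpoly mat \<Rightarrow> bool"
where
  "cycles J \<epsilon> D i A \<longleftrightarrow>
    (case i of 0 \<Rightarrow> entries_in J (row_mat \<epsilon> * A) | Suc j \<Rightarrow> D j * A = 0\<^sub>m (dim_row (D j)) (dim_col A))"

context
  fixes V :: "nat set" and J :: "'a::comm_ring_1 mpoly set" and s \<epsilon> D
  assumes res: "graded_resolution V J s \<epsilon> D"
begin

lemma res_eps: "\<epsilon> \<in> free_module V (length (s 0))"
  using res by (simp add: graded_resolution_def)

lemma res_row_mat: "hmat V [0] (s 0) (row_mat \<epsilon>)"
  using res by (simp add: graded_resolution_def)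

lemma res_hmat: "hmat V (s i) (s (Suc i)) (D i)"
  using res by (simp add: graded_resolution_def)

lemma res_exact0:
  "f \<in> free_module V (length (s 0)) \<Longrightarrow> \<epsilon> \<bullet> f \<in> J \<longleftrightarrow> (\<exists>g \<in> free_module V (length (s 1)). f = D 0 *\<^sub>v g)"
  using res unfolding graded_resolution_def by blast

lemma res_exact:
  "f \<in> free_module V (length (s (Suc i))) \<Longrightarrow>
    D i *\<^sub>v f = 0\<^sub>v (length (s i)) \<longleftrightarrow> (\<exists>g \<in> free_module V (length (s (Suc (Suc i)))). f = D (Suc i) *\<^sub>v g)"
  using res unfolding graded_resolution_def by blast

lemma res_surj: "g \<in> polys V \<Longrightarrow> \<exists>f \<in> free_module V (length (s 0)). g - \<epsilon> \<bullet> f \<in> J"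
  using res by (simp add: graded_resolution_def)

lemma row_mat_mult_index:
  "j < dim_col A \<Longrightarrow> dim_row A = length (s 0) \<Longrightarrow> (row_mat \<epsilon> * A) $$ (0, j) = \<epsilon> \<bullet> col A j"
  using hmat_dim[OF res_row_mat] by (simp add: row_row_mat)

text \<open>Exactness gives a preimage of each column, and \<open>hmat_lift\<close> makes the choice
  homogeneous. The case \<open>i = 0\<close> uses exactness at \<open>F\<^sub>0\<close>, where being
  a cycle is tested modulo \<open>J\<close>.\<close>

lemma cycles_lift:
  assumes A: "hmat V (s i) c A" and cyc: "cycles J \<epsilon> D i A"
  shows "\<exists>B. hmat V (s (Suc i)) c B \<and> D i * B = A"
proof (rule hmat_lift[OF res_hmat A])
  fix q assume q: "q < length c"
  have col: "col A q \<in> free_module V (length (s i))" using hmat_col[OF A q] .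
  have dA: "dim_row A = length (s i)" "dim_col A = length c" using hmat_dim[OF A] by auto
  show "\<exists>f \<in> free_module V (length (s (Suc i))). D i *\<^sub>v f = col A q"
  proof (cases i)
    case 0
    have "\<epsilon> \<bullet> col A q \<in> J"
      using cyc q dA row_mat_mult_index[of q A] hmat_dim[OF res_row_mat] 0
      by (auto simp: cycles_def entries_in_def)
    then have "\<exists>g \<in> free_module V (length (s 1)). col A q = D 0 *\<^sub>v g"
      using res_exact0 col[unfolded 0] by blast
    then show ?thesis unfolding 0 One_nat_def by metis
  next
    case (Suc j)
    have "D j *\<^sub>v col A q = col (D j * A) q"
      using q dA hmat_dim[OF res_hmat[of j]] by (intro eq_vecI) auto
    also have "D j * A = 0\<^sub>m (length (s j)) (length c)"
      using cyc Suc dA hmat_dim[OF res_hmat[of j]] by (simp add: cycles_def)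
    finally have "D j *\<^sub>v col A q = 0\<^sub>v (length (s j))" using q by simp
    then have "\<exists>g \<in> free_module V (length (s (Suc (Suc j)))). col A q = D (Suc j) *\<^sub>v g"
      using res_exact col[unfolded Suc] by blast
    then show ?thesis unfolding Suc by metis
  qed
qed

text \<open>Each column of \<open>D i\<close> is the image of a unit vector, so exactness makes it a
  cycle.\<close>

lemma cycles_boundary: "cycles J \<epsilon> D i (D i)"
proof (cases i)
  case 0
  have "(row_mat \<epsilon> * D 0) $$ (0, q) \<in> J" if q: "q < length (s 1)" for q
  proof -
    have "col (D 0) q = D 0 *\<^sub>v unit_vec (length (s 1)) q"
      using mult_mat_unit_vec[OF hmat_carrier[OF res_hmat[of 0]]] q by simp
    then have "\<exists>g \<in> free_module V (length (s 1)). col (D 0) q = D 0 *\<^sub>v g"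
      using unit_vec_free_module by blast
    moreover have "col (D 0) q \<in> free_module V (length (s 0))"
      using hmat_col[OF res_hmat[of 0]] q by simp
    ultimately have "\<epsilon> \<bullet> col (D 0) q \<in> J"
      using res_exact0 by blast
    then show ?thesis using row_mat_mult_index[of q "D 0"] q hmat_dim[OF res_hmat[of 0]] by simp
  qed
  then show ?thesis
    using 0 hmat_dim[OF res_hmat[of 0]] hmat_dim[OF res_row_mat] by (auto simp: cycles_def entries_in_def)
next
  case (Suc j)
  have "col (D j * D (Suc j)) q = 0\<^sub>v (length (s j))" if q: "q < length (s (Suc (Suc j)))" for q
  proof -
    have "col (D (Suc j)) q = D (Suc j) *\<^sub>v unit_vec (length (s (Suc (Suc j)))) q"
      using mult_mat_unit_vec[OF hmat_carrier[OF res_hmat[of "Suc j"]]] q by simp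
    then have "\<exists>g \<in> free_module V (length (s (Suc (Suc j)))). col (D (Suc j)) q = D (Suc j) *\<^sub>v g"
      using unit_vec_free_module by blast
    moreover have "col (D (Suc j)) q \<in> free_module V (length (s (Suc j)))"
      using hmat_col[OF res_hmat[of "Suc j"]] q by simp
    ultimately have "D j *\<^sub>v col (D (Suc j)) q = 0\<^sub>v (length (s j))"
      using res_exact by blast
    moreover have "D j *\<^sub>v col (D (Suc j)) q = col (D j * D (Suc j)) q"
      using q hmat_dim[OF res_hmat[of j]] hmat_dim[OF res_hmat[of "Suc j"]] by (intro eq_vecI) auto
    ultimately show ?thesis by simp
  qed
  then have "D j * D (Suc j) = 0\<^sub>m (length (s j)) (length (s (Suc (Suc j))))"
    using hmat_dim[OF res_hmat[of j]] hmat_dim[OF res_hmat[of "Suc j"]]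
    by (intro mat_col_eqI) auto
  then show ?thesis
    using Suc hmat_dim[OF res_hmat[of j]] hmat_dim[OF res_hmat[of "Suc j"]] by (simp add: cycles_def)
qed

lemma res_DD: "D i * D (Suc i) = 0\<^sub>m (length (s i)) (length (s (Suc (Suc i))))"
  using cycles_boundary[of "Suc i"] hmat_dim[OF res_hmat[of i]] hmat_dim[OF res_hmat[of "Suc i"]]
  by (simp add: cycles_def)

lemma res_epsD: "entries_in J (row_mat \<epsilon> * D 0)"
  using cycles_boundary[of 0] by (simp add: cycles_def)

text \<open>Surjectivity of the augmentation lifts each entry of \<open>G\<close> modulo
  \<open>J\<close>. Passing to homogeneous components keeps the congruence, since \<open>J\<close>
  is closed under them.\<close>

lemma eps_lift:
  assumes J: "\<And>p d. p \<in> J \<Longrightarrow> hom_part d p \<in> J" and G: "hmat V [0] c G"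
  shows "\<exists>B. hmat V (s 0) c B \<and> entries_in J (G - row_mat \<epsilon> * B)"
proof -
  have "\<exists>f \<in> free_module V (length (s 0)). G $$ (0, q) - \<epsilon> \<bullet> f \<in> J" if "q < length c" for q
    using res_surj G that by (simp add: hmat_def)
  then obtain f where f: "\<And>q. q < length c \<Longrightarrow> f q \<in> free_module V (length (s 0))"
      and fJ: "\<And>q. q < length c \<Longrightarrow> G $$ (0, q) - \<epsilon> \<bullet> f q \<in> J"
    by metis
  have "(G - row_mat \<epsilon> * hom_cols (s 0) c f) $$ (0, q) \<in> J" if q: "q < length c" for q
  proof -
    have "(row_mat \<epsilon> * hom_cols (s 0) c f) $$ (0, q) = hom_part (c ! q) (\<epsilon> \<bullet> f q)"
      using mult_hom_cols[where p = 0 and f = f, OF res_row_mat f _ q] hmat_dim[OF res_row_mat] by (simp add: row_row_mat)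
    moreover have "G $$ (0, q) = hom_part (c ! q) (G $$ (0, q))"
      using G q by (intro hom_part_homogeneous[symmetric]) (simp add: hmat_def)
    ultimately have "(G - row_mat \<epsilon> * hom_cols (s 0) c f) $$ (0, q) = hom_part (c ! q) (G $$ (0, q) - \<epsilon> \<bullet> f q)"
      using hmat_dim[OF res_row_mat] q by (simp add: hom_part_def restrict_mons_diff hom_cols_def)
    then show ?thesis using J[OF fJ[OF q]] by simp
  qed
  then have "entries_in J (G - row_mat \<epsilon> * hom_cols (s 0) c f)"
    using hmat_dim[OF res_row_mat] by (auto simp: entries_in_def hom_cols_def)
  with hmat_hom_cols[of c f V "s 0"] f show ?thesis by blast
qed

end


section \<open>Comparison of resolutions\<close>

lemma index_minus_carrier:
  assumes "B \<in> carrier_mat n m" "i < n" "j < m"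
  shows "(A - B) $$ (i, j) = A $$ (i, j) - B $$ (i, j)"
  using assms by (intro index_minus_mat(1)) auto

lemma mat_minus_minus:
  fixes A B :: "'a::comm_ring_1 mat"
  assumes "A \<in> carrier_mat n m" "B \<in> carrier_mat n m"
  shows "A - (A - B) = B"
  using assms by (intro eq_matI) auto

text \<open>Expresses the sum of \<open>A - B\<close> and \<open>B - C\<close> by differences only,
  so that \<open>entries_in_diff\<close> is applicable to it.\<close>

lemma mat_minus_telescope:
  fixes A B C :: "'a::comm_ring_1 mat"
  assumes "A \<in> carrier_mat n m" "B \<in> carrier_mat n m" "C \<in> carrier_mat n m"
  shows "(A - B) - (0\<^sub>m n m - (B - C)) = A - C"
  using assms by (intro eq_matI) auto

section \<open>Lifting to chain maps and homotopies\<close>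

text \<open>The comparison theorem for the map from \<open>R/L\<close>, twisted by \<open>d\<close>,
  to \<open>R/J\<close> given by multiplication with \<open>f\<close>, which is well defined because
  \<open>f\<close> carries \<open>L\<close> into \<open>J\<close>. Freeness of the source and
  exactness of the target allow lifting one degree at a time. It is used with \<open>f = 1\<close>
  for uniqueness and with a squarefree monomial for mapping cones.\<close>

lemma comparison:
  fixes J L :: "'a::comm_ring_1 mpoly set"
  assumes F: "graded_resolution V J s \<epsilon> D" and G: "graded_resolution V L t \<eta> E"
    and ideal: "ideal J (poly_ring V)" and hom: "\<And>p d. p \<in> J \<Longrightarrow> hom_part d p \<in> J"
    and f: "f \<in> polys V" "homogeneous d f" and fL: "\<And>r. r \<in> L \<Longrightarrow> f * r \<in> J"
  shows "\<exists>\<phi>. (\<forall>i. hmat V (s i) (map ((+) d) (t i)) (\<phi> i)) \<and>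
    entries_in J (f \<cdot>\<^sub>m row_mat \<eta> - row_mat \<epsilon> * \<phi> 0) \<and> (\<forall>i. D i * \<phi> (Suc i) = \<phi> i * E i)"
proof -
  \<comment> \<open>Invariant of the recursive choice: the composite with \<open>E i\<close> is a
    cycle, so that the next component exists. The last clause records that component 0 covers
    multiplication by \<open>f\<close>.\<close>
  define P where "P i A \<longleftrightarrow> hmat V (s i) (map ((+) d) (t i)) A \<and> cycles J \<epsilon> D i (A * E i) \<and>
    (i = 0 \<longrightarrow> entries_in J (f \<cdot>\<^sub>m row_mat \<eta> - row_mat \<epsilon> * A))" for i A
  have E: "hmat V (map ((+) d) (t i)) (map ((+) d) (t (Suc i))) (E i)" for i
    using res_hmat[OF G] by (simp add: hmat_shift)
  have dE: "E i \<in> carrier_mat (length (t i)) (length (t (Suc i)))" for i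
    using hmat_carrier[OF res_hmat[OF G]] .
  have dD: "D i \<in> carrier_mat (length (s i)) (length (s (Suc i)))" for i
    using hmat_carrier[OF res_hmat[OF F]] .
  have d\<epsilon>: "row_mat \<epsilon> \<in> carrier_mat 1 (length (s 0))" using hmat_carrier[OF res_row_mat[OF F]] by simp
  have d\<eta>: "row_mat \<eta> \<in> carrier_mat 1 (length (t 0))" using hmat_carrier[OF res_row_mat[OF G]] by simp
  have "\<exists>\<phi>. \<forall>i. P i (\<phi> i) \<and> D i * \<phi> (Suc i) = \<phi> i * E i"
  proof (rule dependent_nat_choice)
    have f\<eta>: "hmat V [0] (map ((+) d) (t 0)) (f \<cdot>\<^sub>m row_mat \<eta>)"
      unfolding hmat_def
    proof (intro conjI allI impI)
      fix p q assume pq: "p < length [0::int]" "q < length (map ((+) d) (t 0))"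
      then have eq: "(f \<cdot>\<^sub>m row_mat \<eta>) $$ (p, q) = f * row_mat \<eta> $$ (p, q)" using d\<eta> by simp
      have *: "row_mat \<eta> $$ (p, q) \<in> polys V \<and> homogeneous (t 0 ! q) (row_mat \<eta> $$ (p, q))"
        using res_row_mat[OF G] pq by (simp add: hmat_def)
      show "(f \<cdot>\<^sub>m row_mat \<eta>) $$ (p, q) \<in> polys V"
        unfolding eq using * f by (intro polys_closed) auto
      show "homogeneous (map ((+) d) (t 0) ! q - [0] ! p) ((f \<cdot>\<^sub>m row_mat \<eta>) $$ (p, q))"
        unfolding eq using * homogeneous_mult[OF f(2)] pq by simp
    qed (use d\<eta> in simp)
    obtain A where A: "hmat V (s 0) (map ((+) d) (t 0)) A"
        and base: "entries_in J (f \<cdot>\<^sub>m row_mat \<eta> - row_mat \<epsilon> * A)"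
      using eps_lift[OF F hom f\<eta>] by blast
    have dA: "A \<in> carrier_mat (length (s 0)) (length (t 0))" using hmat_carrier[OF A] by simp
    have "(f \<cdot>\<^sub>m row_mat \<eta> - row_mat \<epsilon> * A) * E 0 = f \<cdot>\<^sub>m (row_mat \<eta> * E 0) - row_mat \<epsilon> * (A * E 0)"
      using minus_mult_distrib_mat[of "f \<cdot>\<^sub>m row_mat \<eta>" 1 "length (t 0)" "row_mat \<epsilon> * A" "E 0"]
        mult_smult_assoc_mat[OF d\<eta> dE[of 0], of f] assoc_mult_mat[OF d\<epsilon> dA dE[of 0]] d\<eta> d\<epsilon> dA dE[of 0]
      by simp
    \<comment> \<open>Both terms on the right have entries in \<open>J\<close>: the matrix
      \<open>row_mat \<eta> * E 0\<close> has entries in \<open>L\<close>, which \<open>f\<close>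
      carries into \<open>J\<close>, and the other factor is the congruence
      \<open>base\<close>.\<close>
    then have eq: "row_mat \<epsilon> * (A * E 0) = f \<cdot>\<^sub>m (row_mat \<eta> * E 0) - (f \<cdot>\<^sub>m row_mat \<eta> - row_mat \<epsilon> * A) * E 0"
      using mat_minus_minus[of "f \<cdot>\<^sub>m (row_mat \<eta> * E 0)" 1 "length (t (Suc 0))" "row_mat \<epsilon> * (A * E 0)"]
        d\<eta> d\<epsilon> dA dE[of 0]
      by simp
    have "entries_in J (f \<cdot>\<^sub>m (row_mat \<eta> * E 0))"
      using res_epsD[OF G] fL by (auto simp: entries_in_def)
    moreover have "entries_in J ((f \<cdot>\<^sub>m row_mat \<eta> - row_mat \<epsilon> * A) * E 0)"
      by (rule entries_in_mult[where n = 1, OF ideal _ E base]) (auto intro!: carrier_matI simp: carrier_matD[OF d\<epsilon>] carrier_matD[OF dA])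
    ultimately have "entries_in J (row_mat \<epsilon> * (A * E 0))"
      unfolding eq
      by (rule entries_in_diff[where n = 1 and m = "length (t (Suc 0))", OF ideal, rotated 2])
        (auto intro!: carrier_matI simp: carrier_matD[OF d\<eta>] carrier_matD[OF d\<epsilon>] carrier_matD[OF dA] carrier_matD[OF dE[of 0]])
    then have "P 0 A" using A base by (simp add: P_def cycles_def)
    then show "\<exists>A. P 0 A" ..
  next
    fix A i assume "P i A"
    then have A: "hmat V (s i) (map ((+) d) (t i)) A" and cyc: "cycles J \<epsilon> D i (A * E i)"
      by (simp_all add: P_def)
    obtain B where B: "hmat V (s (Suc i)) (map ((+) d) (t (Suc i))) B" and eq: "D i * B = A * E i"
      using cycles_lift[OF F hmat_mult[OF A E] cyc] by blast
    have dA: "A \<in> carrier_mat (length (s i)) (length (t i))" using hmat_carrier[OF A] by simp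
    have dB: "B \<in> carrier_mat (length (s (Suc i))) (length (t (Suc i)))" using hmat_carrier[OF B] by simp
    have "D i * (B * E (Suc i)) = D i * B * E (Suc i)"
      by (rule assoc_mult_mat[OF dD dB dE, symmetric])
    also have "\<dots> = A * (E i * E (Suc i))"
      unfolding eq by (rule assoc_mult_mat[OF dA dE dE])
    also have "\<dots> = 0\<^sub>m (length (s i)) (length (t (Suc (Suc i))))"
      using res_DD[OF G, of i] dA by simp
    finally have "cycles J \<epsilon> D (Suc i) (B * E (Suc i))"
      using dD[of i] dE[of "Suc i"] by (auto simp: cycles_def)
    then have "P (Suc i) B" using B by (simp add: P_def)
    then show "\<exists>B. P (Suc i) B \<and> D i * B = A * E i" using eq by blast
  qed
  then obtain \<phi> where "\<And>i. P i (\<phi> i)" and "\<And>i. D i * \<phi> (Suc i) = \<phi> i * E i" by blast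
  then show ?thesis by (intro exI[of _ \<phi>]) (simp add: P_def)
qed

text \<open>A chain map that vanishes on homology is homotopic to zero, \<open>\<theta> = D h + h D\<close>; minimality puts
  the right-hand side into the irrelevant ideal.\<close>

lemma null_homotopic_const_term:
  fixes J :: "'a::field mpoly set"
  assumes min: "minimal_graded_resolution V J s \<epsilon> D"
    and \<theta>: "\<And>i. hmat V (s i) (s i) (\<theta> i)" and chain: "\<And>i. D i * \<theta> (Suc i) = \<theta> i * D i"
    and \<theta>0: "entries_in J (row_mat \<epsilon> * \<theta> 0)" and pq: "p < length (s i)" "q < length (s i)"
  shows "const_term (\<theta> i $$ (p, q)) = 0"
proof -
  have F: "graded_resolution V J s \<epsilon> D"
    and D0: "\<And>i p q. p < length (s i) \<Longrightarrow> q < length (s (Suc i)) \<Longrightarrow> const_term (D i $$ (p, q)) = 0"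
    using min by (auto simp: minimal_graded_resolution_iff)
  have D: "hmat V (s i) (s (Suc i)) (D i)" for i using res_hmat[OF F] .
  have dD: "D i \<in> carrier_mat (length (s i)) (length (s (Suc i)))" for i
    using hmat_carrier[OF D] .
  have d\<theta>: "\<theta> i \<in> carrier_mat (length (s i)) (length (s i))" for i using hmat_carrier[OF \<theta>] .
  \<comment> \<open>A product inherits vanishing constant terms from either factor.\<close>
  have const: "const_term ((A * B) $$ (p, q)) = 0"
    if "A \<in> carrier_mat n m" "B \<in> carrier_mat m k" "p < n" "q < k"
      "(\<forall>e < m. const_term (A $$ (p, e)) = 0) \<or> (\<forall>e < m. const_term (B $$ (e, q)) = 0)"
    for A B :: "'a mpoly mat" and n m k p q
    using that by (auto simp: scalar_prod_def const_term_sum const_term_mult)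
  \<comment> \<open>The equation says that \<open>\<theta> (Suc i) - h * D i\<close> is a cycle, so
    that the next homotopy component exists. At \<open>i = 0\<close> there is no earlier component,
    hence \<open>\<theta> 0 = D 0 * h\<close>.\<close>
  define P where "P i h \<longleftrightarrow> hmat V (s (Suc i)) (s i) h \<and> D i * (h * D i) = D i * \<theta> (Suc i) \<and>
    (i = 0 \<longrightarrow> \<theta> 0 = D 0 * h)" for i h
  have "\<exists>h. \<forall>i. P i (h i) \<and> \<theta> (Suc i) - h i * D i = D (Suc i) * h (Suc i)"
  proof (rule dependent_nat_choice)
    obtain h where h: "hmat V (s (Suc 0)) (s 0) h" and eq: "D 0 * h = \<theta> 0"
      using cycles_lift[OF F \<theta>[of 0]] \<theta>0 unfolding cycles_def nat.case by blast
    have "D 0 * (h * D 0) = \<theta> 0 * D 0"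
      unfolding eq[symmetric] by (rule assoc_mult_mat[OF dD hmat_carrier[OF h] dD, symmetric])
    then have "P 0 h" using h eq chain by (simp add: P_def)
    then show "\<exists>h. P 0 h" ..
  next
    fix h i assume "P i h"
    then have h: "hmat V (s (Suc i)) (s i) h" and eq: "D i * (h * D i) = D i * \<theta> (Suc i)"
      by (simp_all add: P_def)
    note dh = hmat_carrier[OF h]
    have hD: "h * D i \<in> carrier_mat (length (s (Suc i))) (length (s (Suc i)))" using dh dD by simp
    have "D i * (\<theta> (Suc i) - h * D i) = D i * \<theta> (Suc i) - D i * (h * D i)"
      by (rule mult_minus_distrib_mat[OF dD d\<theta> hD])
    also have "\<dots> = 0\<^sub>m (length (s i)) (length (s (Suc i)))"
      unfolding eq using dD[of i] d\<theta>[of "Suc i"] by (intro minus_r_inv_mat) simp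
    finally have "cycles J \<epsilon> D (Suc i) (\<theta> (Suc i) - h * D i)"
      using dD[of i] hD by (auto simp: cycles_def)
    then obtain h' where h': "hmat V (s (Suc (Suc i))) (s (Suc i)) h'"
        and eq': "D (Suc i) * h' = \<theta> (Suc i) - h * D i"
      using cycles_lift[OF F hmat_diff[OF \<theta> hmat_mult[OF h D]]] by blast
    note dh' = hmat_carrier[OF h']
    have "D (Suc i) * (h' * D (Suc i)) = (\<theta> (Suc i) - h * D i) * D (Suc i)"
      unfolding eq'[symmetric] by (rule assoc_mult_mat[OF dD dh' dD, symmetric])
    also have "\<dots> = \<theta> (Suc i) * D (Suc i) - h * D i * D (Suc i)"
      by (rule minus_mult_distrib_mat[OF d\<theta> hD dD])
    also have "h * D i * D (Suc i) = h * (D i * D (Suc i))"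
      by (rule assoc_mult_mat[OF dh dD dD])
    also have "\<dots> = 0\<^sub>m (length (s (Suc i))) (length (s (Suc (Suc i))))"
      using res_DD[OF F, of i] dh by simp
    also have "\<theta> (Suc i) * D (Suc i) - \<dots> = D (Suc i) * \<theta> (Suc (Suc i))"
      unfolding chain using d\<theta>[of "Suc i"] dD[of "Suc i"] by (intro eq_matI) auto
    finally have "P (Suc i) h'" using h' by (simp add: P_def)
    then show "\<exists>h'. P (Suc i) h' \<and> \<theta> (Suc i) - h * D i = D (Suc i) * h'" using eq' by metis
  qed
  then obtain h where P: "\<And>i. P i (h i)" and eq: "\<And>i. \<theta> (Suc i) - h i * D i = D (Suc i) * h (Suc i)"
    by blast
  have dh: "h i \<in> carrier_mat (length (s (Suc i))) (length (s i))" for i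
    using P[of i] hmat_carrier unfolding P_def by blast
  show ?thesis
  proof (cases i)
    case 0
    then show ?thesis using P[of 0] pq D0 const[OF dD dh, of p 0 q] by (simp add: P_def)
  next
    case (Suc j)
    have hD: "h j * D j \<in> carrier_mat (length (s i)) (length (s i))" using dh[of j] dD[of j] Suc by simp
    \<comment> \<open>Both summands are products with a differential as a factor: the first equals
      \<open>D (Suc j) * h (Suc j)\<close>.\<close>
    have "\<theta> i $$ (p, q) = (\<theta> i - h j * D j) $$ (p, q) + (h j * D j) $$ (p, q)"
      unfolding index_minus_carrier[OF hD pq] by simp
    moreover have "const_term ((\<theta> i - h j * D j) $$ (p, q)) = 0"
      unfolding Suc eq using pq Suc D0 by (intro const[OF dD dh]) auto
    moreover have "const_term ((h j * D j) $$ (p, q)) = 0"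
      using pq Suc D0 by (intro const[OF dh dD]) auto
    ultimately show ?thesis by (simp add: const_term_add)
  qed
qed

section \<open>Comparing degree counts through matrices over the field\<close>

text \<open>If \<open>m < n\<close>, pad both matrices with zeros to size \<open>n\<close>. The
  product is still the identity, but the padded \<open>A\<close> has a zero row and hence
  determinant 0.\<close>

lemma left_inverse_imp_le:
  fixes A B :: "'a::field mat"
  assumes A: "A \<in> carrier_mat m n" and B: "B \<in> carrier_mat n m" and BA: "B * A = 1\<^sub>m n"
  shows "n \<le> m"
proof (rule ccontr)
  assume "\<not> n \<le> m"
  then have mn: "m < n" by simp
  define A' where "A' = mat n n (\<lambda>(i, j). if i < m then A $$ (i, j) else 0)"
  define B' where "B' = mat n n (\<lambda>(i, j). if j < m then B $$ (i, j) else 0)"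
  have "B' * A' = B * A"
  proof (rule eq_matI)
    fix i j assume "i < dim_row (B * A)" "j < dim_col (B * A)"
    then have ij: "i < n" "j < n" using A B by auto
    have "(B' * A') $$ (i, j) = (\<Sum>k = 0..<n. if k < m then B $$ (i, k) * A $$ (k, j) else 0)"
      using ij by (auto simp: A'_def B'_def scalar_prod_def intro!: sum.cong)
    also have "\<dots> = (\<Sum>k = 0..<m. B $$ (i, k) * A $$ (k, j))"
      using mn by (intro sum.mono_neutral_cong_right) auto
    finally show "(B' * A') $$ (i, j) = (B * A) $$ (i, j)"
      using ij A B by (simp add: scalar_prod_def)
  qed (use A B in \<open>auto simp: A'_def B'_def\<close>)
  then have "det B' * det A' = 1"
    using BA det_mult[of B' n A'] by (simp add: A'_def B'_def)
  moreover have "det A' = 0"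
  proof -
    have "A' = mat\<^sub>r n n (\<lambda>i. if i = m then 0\<^sub>v n else row A' i)"
      by (rule eq_matI) (auto simp: A'_def)
    then have "det A' = det (mat\<^sub>r n n (\<lambda>i. if i = m then 0\<^sub>v n else row A' i))"
      by (rule arg_cong)
    also have "\<dots> = 0"
      by (rule det_row_0[OF mn]) (auto simp: A'_def)
    finally show ?thesis .
  qed
  ultimately show False by simp
qed

lemma count_list_filter: "count_list xs x = length (filter (\<lambda>i. xs ! i = x) [0..<length xs])"
proof -
  have "count_list xs x = card {i. i < length xs \<and> xs ! i = x}"
    by (simp add: count_list_eq_length_filter length_filter_conv_card eq_commute)
  then show ?thesis by (simp add: length_filter_conv_card cong: conj_cong)
qed

text \<open>Restrict to the positions of degree \<open>j\<close>. A column of \<open>A\<close> of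
  degree \<open>j\<close> vanishes outside the rows of degree \<open>j\<close>, so dropping the
  other rows leaves the product unchanged: the restricted \<open>A\<close> still has a left inverse,
  and \<open>left_inverse_imp_le\<close> applies.\<close>

lemma degree_count_le:
  fixes A B :: "'a::field mat"
  assumes A: "A \<in> carrier_mat (length t) (length s)" and B: "B \<in> carrier_mat (length s) (length t)"
    and BA: "B * A = 1\<^sub>m (length s)"
    and deg: "\<And>p q. p < length t \<Longrightarrow> q < length s \<Longrightarrow> A $$ (p, q) \<noteq> 0 \<Longrightarrow> t ! p = s ! q"
  shows "count_list s j \<le> count_list t j"
proof -
  define qs where "qs = filter (\<lambda>i. s ! i = j) [0..<length s]"
  define ps where "ps = filter (\<lambda>i. t ! i = j) [0..<length t]"
  define A' where "A' = mat (length ps) (length qs) (\<lambda>(a, b). A $$ (ps ! a, qs ! b))"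
  define B' where "B' = mat (length qs) (length ps) (\<lambda>(b, a). B $$ (qs ! b, ps ! a))"
  have dist: "distinct qs" "distinct ps" by (simp_all add: qs_def ps_def)
  have qs: "qs ! b < length s" "s ! (qs ! b) = j" if "b < length qs" for b
    using nth_mem[OF that] by (auto simp: qs_def)
  have "B' * A' = 1\<^sub>m (length qs)"
  proof (rule eq_matI)
    fix b b' assume "b < dim_row (1\<^sub>m (length qs) :: 'a mat)" "b' < dim_col (1\<^sub>m (length qs) :: 'a mat)"
    then have b: "b < length qs" "b' < length qs" by auto
    have "(B' * A') $$ (b, b') = (\<Sum>a = 0..<length ps. B $$ (qs ! b, ps ! a) * A $$ (ps ! a, qs ! b'))"
      using b by (simp add: A'_def B'_def scalar_prod_def)
    also have "\<dots> = (\<Sum>p \<in> set ps. B $$ (qs ! b, p) * A $$ (p, qs ! b'))"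
      by (rule sum.reindex_bij_betw) (rule bij_betw_nth[OF dist(2)], auto)
    also have "\<dots> = (\<Sum>p = 0..<length t. B $$ (qs ! b, p) * A $$ (p, qs ! b'))"
      using deg qs[OF b(2)] by (intro sum.mono_neutral_left) (auto simp: ps_def)
    also have "\<dots> = (B * A) $$ (qs ! b, qs ! b')"
      using A B qs(1) b by (simp add: scalar_prod_def)
    also have "\<dots> = 1\<^sub>m (length qs) $$ (b, b')"
      unfolding BA using qs(1) b dist(1) by (simp add: nth_eq_iff_index_eq)
    finally show "(B' * A') $$ (b, b') = 1\<^sub>m (length qs) $$ (b, b')" .
  qed (auto simp: A'_def B'_def)
  then have "length qs \<le> length ps"
    by (intro left_inverse_imp_le[of A' _ _ B']) (auto simp: A'_def B'_def)
  then show ?thesis by (simp add: count_list_filter qs_def ps_def)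
qed

section \<open>Uniqueness of the graded Betti numbers\<close>

text \<open>Lift the identity of \<open>R/J\<close> in both directions. Then
  \<open>1 - \<psi> * \<phi>\<close> is a chain map inducing zero on \<open>R/J\<close>, so its
  constant terms vanish by \<open>null_homotopic_const_term\<close>, and the constant terms of
  \<open>\<psi>\<close> are a left inverse of those of \<open>\<phi>\<close>.\<close>

lemma minimal_graded_resolution_count_le:
  fixes J :: "'a::field mpoly set"
  assumes F: "minimal_graded_resolution V J s \<epsilon> D" and G: "minimal_graded_resolution V J t \<eta> E"
    and ideal: "ideal J (poly_ring V)" and hom: "\<And>p d. p \<in> J \<Longrightarrow> hom_part d p \<in> J"
  shows "count_list (s i) j \<le> count_list (t i) j"
proof -
  have F': "graded_resolution V J s \<epsilon> D" and G': "graded_resolution V J t \<eta> E"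
    using F G by (simp_all add: minimal_graded_resolution_iff)
  \<comment> \<open>For \<open>f = 1\<close> and \<open>d = 0\<close> these two rules remove the
    twist and the scalar factor from \<open>comparison\<close>.\<close>
  have [simp]: "map ((+) 0) xs = xs" for xs :: "int list" by (simp add: map_idI)
  have [simp]: "1 \<cdot>\<^sub>m M = M" for M :: "'a mpoly mat" by (rule eq_matI) auto
  have "\<exists>\<phi>. (\<forall>i. hmat V (t i) (s i) (\<phi> i)) \<and> entries_in J (row_mat \<epsilon> - row_mat \<eta> * \<phi> 0) \<and>
      (\<forall>i. E i * \<phi> (Suc i) = \<phi> i * D i)"
    using comparison[OF G' F' ideal hom polys_1 homogeneous_1] by simp
  then obtain \<phi> where \<phi>: "\<And>i. hmat V (t i) (s i) (\<phi> i)"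
      and \<phi>0: "entries_in J (row_mat \<epsilon> - row_mat \<eta> * \<phi> 0)"
      and \<phi>D: "\<And>i. E i * \<phi> (Suc i) = \<phi> i * D i"
    by blast
  have "\<exists>\<psi>. (\<forall>i. hmat V (s i) (t i) (\<psi> i)) \<and> entries_in J (row_mat \<eta> - row_mat \<epsilon> * \<psi> 0) \<and>
      (\<forall>i. D i * \<psi> (Suc i) = \<psi> i * E i)"
    using comparison[OF F' G' ideal hom polys_1 homogeneous_1] by simp
  then obtain \<psi> where \<psi>: "\<And>i. hmat V (s i) (t i) (\<psi> i)"
      and \<psi>0: "entries_in J (row_mat \<eta> - row_mat \<epsilon> * \<psi> 0)"
      and \<psi>D: "\<And>i. D i * \<psi> (Suc i) = \<psi> i * E i"
    by blast
  note dD = hmat_carrier[OF res_hmat[OF F']] and dE = hmat_carrier[OF res_hmat[OF G']]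
  note d\<phi> = hmat_carrier[OF \<phi>] and d\<psi> = hmat_carrier[OF \<psi>]
  have d\<epsilon>: "row_mat \<epsilon> \<in> carrier_mat 1 (length (s 0))" using hmat_carrier[OF res_row_mat[OF F']] by simp
  have d\<eta>: "row_mat \<eta> \<in> carrier_mat 1 (length (t 0))" using hmat_carrier[OF res_row_mat[OF G']] by simp
  define \<theta> where "\<theta> i = 1\<^sub>m (length (s i)) - \<psi> i * \<phi> i" for i
  have \<psi>\<phi>: "\<psi> i * \<phi> i \<in> carrier_mat (length (s i)) (length (s i))" for i using d\<phi>[of i] d\<psi>[of i] by simp
  have const: "const_term (\<theta> i $$ (p, q)) = 0" if pq: "p < length (s i)" "q < length (s i)" for p q
  proof (rule null_homotopic_const_term[OF F _ _ _ pq])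
    show "hmat V (s i) (s i) (\<theta> i)" for i
      unfolding \<theta>_def by (intro hmat_diff hmat_one hmat_mult[OF \<psi> \<phi>])
    show "D i * \<theta> (Suc i) = \<theta> i * D i" for i
    proof -
      have "D i * \<theta> (Suc i) = D i - D i * (\<psi> (Suc i) * \<phi> (Suc i))"
        unfolding \<theta>_def mult_minus_distrib_mat[OF dD one_carrier_mat \<psi>\<phi>] right_mult_one_mat[OF dD] ..
      also have "D i * (\<psi> (Suc i) * \<phi> (Suc i)) = \<psi> i * (E i * \<phi> (Suc i))"
        unfolding assoc_mult_mat[OF dD d\<psi> d\<phi>, symmetric] \<psi>D by (rule assoc_mult_mat[OF d\<psi> dE d\<phi>])
      also have "\<dots> = \<psi> i * \<phi> i * D i"
        unfolding \<phi>D by (rule assoc_mult_mat[OF d\<psi> d\<phi> dD, symmetric])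
      also have "D i - \<dots> = \<theta> i * D i"
        unfolding \<theta>_def minus_mult_distrib_mat[OF one_carrier_mat \<psi>\<phi> dD] left_mult_one_mat[OF dD] ..
      finally show ?thesis .
    qed
    \<comment> \<open>This is the sum of \<open>\<epsilon> - \<eta> \<phi>\<close> and
      \<open>(\<eta> - \<epsilon> \<psi>) \<phi>\<close>, both with entries in \<open>J\<close> by
      the two lifting congruences.\<close>
    have "row_mat \<epsilon> * \<theta> 0 =
        (row_mat \<epsilon> - row_mat \<eta> * \<phi> 0) - ((0\<^sub>m 1 (length (s 0)) - (row_mat \<eta> - row_mat \<epsilon> * \<psi> 0) * \<phi> 0))"
    proof -
      have "row_mat \<epsilon> * \<theta> 0 = row_mat \<epsilon> - row_mat \<epsilon> * (\<psi> 0 * \<phi> 0)"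
        unfolding \<theta>_def mult_minus_distrib_mat[OF d\<epsilon> one_carrier_mat \<psi>\<phi>] right_mult_one_mat[OF d\<epsilon>] ..
      moreover have "(row_mat \<eta> - row_mat \<epsilon> * \<psi> 0) * \<phi> 0 = row_mat \<eta> * \<phi> 0 - row_mat \<epsilon> * (\<psi> 0 * \<phi> 0)"
        unfolding assoc_mult_mat[OF d\<epsilon> d\<psi> d\<phi>, symmetric]
        by (rule minus_mult_distrib_mat[OF d\<eta> mult_carrier_mat[OF d\<epsilon> d\<psi>] d\<phi>])
      ultimately show ?thesis
        using mat_minus_telescope[of "row_mat \<epsilon>" 1 "length (s 0)" "row_mat \<eta> * \<phi> 0" "row_mat \<epsilon> * (\<psi> 0 * \<phi> 0)"]
          d\<epsilon> mult_carrier_mat[OF d\<eta> d\<phi>] mult_carrier_mat[OF d\<epsilon> \<psi>\<phi>] by simp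
    qed
    also have "entries_in J \<dots>"
    proof -
      have z: "entries_in J (0\<^sub>m 1 (length (s 0)))"
        using ideal_poly_ringD(1)[OF ideal] by (simp add: entries_in_def)
      have "entries_in J ((row_mat \<eta> - row_mat \<epsilon> * \<psi> 0) * \<phi> 0)"
        by (rule entries_in_mult[where n = 1, OF ideal _ \<phi> \<psi>0]) (auto intro!: carrier_matI simp: carrier_matD[OF d\<epsilon>] carrier_matD[OF d\<psi>[of 0]])
      with z have "entries_in J (0\<^sub>m 1 (length (s 0)) - (row_mat \<eta> - row_mat \<epsilon> * \<psi> 0) * \<phi> 0)"
        by (rule entries_in_diff[where n = 1 and m = "length (s 0)", OF ideal, rotated 2])
          (auto intro!: carrier_matI simp: carrier_matD[OF d\<epsilon>] carrier_matD[OF d\<psi>[of 0]] carrier_matD[OF d\<phi>[of 0]])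
      with \<phi>0 show ?thesis
        by (rule entries_in_diff[where n = 1 and m = "length (s 0)", OF ideal, rotated 2])
          (auto intro!: carrier_matI simp: carrier_matD[OF d\<epsilon>] carrier_matD[OF d\<eta>] carrier_matD[OF d\<psi>[of 0]] carrier_matD[OF d\<phi>[of 0]])
    qed
    finally show "entries_in J (row_mat \<epsilon> * \<theta> 0)" .
  qed
  \<comment> \<open>Reduction of the chain maps modulo the irrelevant ideal gives matrices over the
    field.\<close>
  define A where "A = map_mat const_term (\<phi> i)"
  define B where "B = map_mat const_term (\<psi> i)"
  show ?thesis
  proof (rule degree_count_le)
    show "A \<in> carrier_mat (length (t i)) (length (s i))" using d\<phi>[of i] by (simp add: A_def)
    show "B \<in> carrier_mat (length (s i)) (length (t i))" using d\<psi>[of i] by (simp add: B_def)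
    show "B * A = 1\<^sub>m (length (s i))"
    proof (rule eq_matI)
      fix p q assume "p < dim_row (1\<^sub>m (length (s i)) :: 'a mat)" "q < dim_col (1\<^sub>m (length (s i)) :: 'a mat)"
      then have pq: "p < length (s i)" "q < length (s i)" by auto
      have "(B * A) $$ (p, q) = const_term ((\<psi> i * \<phi> i) $$ (p, q))"
        using pq d\<phi>[of i] d\<psi>[of i] by (simp add: A_def B_def scalar_prod_def const_term_sum const_term_mult)
      moreover have "const_term (1\<^sub>m (length (s i)) $$ (p, q) - (\<psi> i * \<phi> i) $$ (p, q) :: 'a mpoly) = 0"
        using const[OF pq] unfolding \<theta>_def index_minus_carrier[OF \<psi>\<phi> pq] .
      ultimately show "(B * A) $$ (p, q) = 1\<^sub>m (length (s i)) $$ (p, q)"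
        using pq by (auto simp: const_term_diff split: if_splits)
    qed (use d\<phi>[of i] d\<psi>[of i] in \<open>auto simp: A_def B_def\<close>)
    fix p q assume pq: "p < length (t i)" "q < length (s i)" and nz: "A $$ (p, q) \<noteq> 0"
    \<comment> \<open>A nonzero constant term is possible only in degree 0, so the two degrees
      agree.\<close>
    have "homogeneous (s i ! q - t i ! p) (\<phi> i $$ (p, q))" using \<phi>[of i] pq by (simp add: hmat_def)
    then show "t i ! p = s i ! q"
      using const_term_homogeneous nz pq d\<phi>[of i] by (fastforce simp: A_def)
  qed
qed

text \<open>Applying the inequality in both directions shows that all minimal resolutions have the
  same count, which justifies the definite description.\<close>

lemma graded_betti_eq:
  fixes J :: "'a::field mpoly set"
  assumes F: "minimal_graded_resolution V J s \<epsilon> D"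
    and ideal: "ideal J (poly_ring V)" and hom: "\<And>p d. p \<in> J \<Longrightarrow> hom_part d p \<in> J"
  shows "graded_betti V J i j = count_list (s i) j"
  unfolding graded_betti_def
proof (rule the_equality)
  show "\<exists>s' \<epsilon> D. minimal_graded_resolution V J s' \<epsilon> D \<and> count_list (s i) j = count_list (s' i) j"
    using F by blast
  show "b = count_list (s i) j"
    if "\<exists>s' \<epsilon> D. minimal_graded_resolution V J s' \<epsilon> D \<and> b = count_list (s' i) j" for b
    using that minimal_graded_resolution_count_le[OF F _ ideal hom]
      minimal_graded_resolution_count_le[OF _ F ideal hom] by (meson antisym)
qed


section \<open>Mapping cones\<close>

lemma free_module_append:
  assumes "c \<in> free_module V n" "b \<in> free_module V m"
  shows "c @\<^sub>v b \<in> free_module V (n + m)"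
  using assms by (auto simp: free_module_def)

lemma free_module_appendE:
  assumes "h \<in> free_module V (n + m)"
  obtains c b where "c \<in> free_module V n" "b \<in> free_module V m" "h = c @\<^sub>v b"
proof
  show "vec_first h n \<in> free_module V n" "vec_last h m \<in> free_module V m"
    using assms by (auto simp: free_module_def vec_first_def vec_last_def)
  show "h = vec_first h n @\<^sub>v vec_last h m"
    using free_module_carrier[OF assms] by simp
qed

lemma free_module_add:
  "a \<in> free_module V n \<Longrightarrow> b \<in> free_module V n \<Longrightarrow> a + (b :: 'a::comm_ring_1 mpoly vec) \<in> free_module V n"
  by (auto simp: free_module_def intro!: polys_closed(1))

lemma free_module_diff:
  "a \<in> free_module V n \<Longrightarrow> b \<in> free_module V n \<Longrightarrow> a - (b :: 'a::comm_ring_1 mpoly vec) \<in> free_module V n"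
  by (auto simp: free_module_def intro!: polys_diff)

lemma free_module_uminus:
  "a \<in> free_module V n \<Longrightarrow> - (a :: 'a::comm_ring_1 mpoly vec) \<in> free_module V n"
  by (auto simp: free_module_def intro!: polys_uminus)

lemma scalar_prod_polys:
  fixes a b :: "'a::comm_ring_1 mpoly vec"
  assumes "a \<in> free_module V n" "b \<in> free_module V n"
  shows "a \<bullet> b \<in> polys V"
  unfolding scalar_prod_def using assms by (intro polys_sum polys_closed(2)) (auto simp: free_module_def)

lemma vec_add_diff_cancel:
  fixes a b :: "'a::comm_ring_1 vec"
  assumes "a \<in> carrier_vec n" "b \<in> carrier_vec n"
  shows "a + b - b = a" and "a - b + b = a"
  using assms by (auto intro!: eq_vecI)

lemma mult_mat_uminus_vec:
  fixes A :: "'a::comm_ring_1 mat"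
  assumes "A \<in> carrier_mat n m" "v \<in> carrier_vec m"
  shows "A *\<^sub>v (- v) = - (A *\<^sub>v v)"
  using assms by (intro eq_vecI) (auto simp: scalar_prod_def sum_negf)

lemma hmat_four_block:
  assumes A: "hmat V a c A" and B: "hmat V a d B" and C: "hmat V b c C" and D: "hmat V b d D"
  shows "hmat V (a @ b) (c @ d) (four_block_mat A B C D)"
  unfolding hmat_def
proof (intro conjI allI impI)
  note dims = hmat_dim[OF A] hmat_dim[OF D]
  show "four_block_mat A B C D \<in> carrier_mat (length (a @ b)) (length (c @ d))"
    using dims by (intro carrier_matI) auto
  fix p q assume pq: "p < length (a @ b)" "q < length (c @ d)"
  show "four_block_mat A B C D $$ (p, q) \<in> polys V"
    "homogeneous ((c @ d) ! q - (a @ b) ! p) (four_block_mat A B C D $$ (p, q))"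
    using A B C D pq dims by (auto simp: hmat_def nth_append)
qed

lemma hmat_uminus:
  fixes A :: "'a::comm_ring_1 mpoly mat"
  shows "hmat V a b A \<Longrightarrow> hmat V a b (- A)"
  by (auto simp: hmat_def intro!: polys_uminus homogeneous_uminus)

lemma hmat_zero: "hmat V a b (0\<^sub>m (length a) (length b))"
  by (simp add: hmat_def)

text \<open>The mapping cone of \<open>\<phi> : G(-d) \<rightarrow> F\<close> is \<open>F\<^sub>i \<oplus> G\<^sub>i\<^sub>-\<^sub>1(-d)\<close> in degree \<open>i\<close>. In \<open>cone_diff\<close> only the length of
  \<open>shift_degs 0 t i\<close> matters, so the shift is irrelevant there.\<close>

definition shift_degs :: "int \<Rightarrow> (nat \<Rightarrow> int list) \<Rightarrow> nat \<Rightarrow> int list" where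
  "shift_degs d t i = (case i of 0 \<Rightarrow> [] | Suc j \<Rightarrow> map ((+) d) (t j))"

text \<open>The sign makes cone differentials compose to zero, by cancelling \<open>D \<phi>\<close>
  against \<open>\<phi> E\<close>. In degree 0 the target is the zero module, hence a matrix without
  rows.\<close>

definition shift_diff :: "(nat \<Rightarrow> int list) \<Rightarrow> (nat \<Rightarrow> 'a::comm_ring_1 mat) \<Rightarrow> nat \<Rightarrow> 'a mat" where
  "shift_diff t E i = (case i of 0 \<Rightarrow> 0\<^sub>m 0 (length (t 0)) | Suc j \<Rightarrow> - E j)"

definition cone_diff ::
  "(nat \<Rightarrow> int list) \<Rightarrow> (nat \<Rightarrow> int list) \<Rightarrow> (nat \<Rightarrow> 'a::comm_ring_1 mat) \<Rightarrow> (nat \<Rightarrow> 'a mat) \<Rightarrow> (nat \<Rightarrow> 'a mat) \<Rightarrow> nat \<Rightarrow> 'a mat"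
where
  "cone_diff s t D E \<phi> i =
    four_block_mat (D i) (\<phi> i) (0\<^sub>m (length (shift_degs 0 t i)) (length (s (Suc i)))) (shift_diff t E i)"

section \<open>Exactness and minimality of the cone\<close>

text \<open>The hypotheses say that \<open>L\<close> is the colon ideal \<open>J : f\<close> and
  \<open>J'\<close> is \<open>J + (f)\<close>. Multiplication by \<open>f\<close> then embeds
  \<open>R/L\<close>, twisted by \<open>d\<close>, into \<open>R/J\<close> with cokernel
  \<open>R/J'\<close>, so the cone of a lift \<phi> resolves \<open>R/J'\<close>. The condition
  \<open>deg\<close> excludes entries of degree 0 in \<phi>, which keeps the cone minimal.\<close>

theorem mapping_cone:
  fixes J L J' :: "'a::field mpoly set"
  assumes F: "minimal_graded_resolution V J s \<epsilon> D" and G: "minimal_graded_resolution V L t \<eta> E"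
    and ideal: "ideal J (poly_ring V)" and hom: "\<And>p d. p \<in> J \<Longrightarrow> hom_part d p \<in> J"
    and f: "f \<in> polys V" "homogeneous d f"
    and L: "L \<subseteq> polys V" "\<And>r. r \<in> polys V \<Longrightarrow> f * r \<in> J \<longleftrightarrow> r \<in> L"
    and J': "\<And>p. p \<in> polys V \<Longrightarrow> p \<in> J' \<longleftrightarrow> (\<exists>r \<in> polys V. p - f * r \<in> J)"
    and deg: "\<And>i a b. a \<in> set (s i) \<Longrightarrow> b \<in> set (t i) \<Longrightarrow> a \<noteq> d + b"
  shows "\<exists>D'. minimal_graded_resolution V J' (\<lambda>i. s i @ shift_degs d t i) \<epsilon> D'"
proof -
  have F': "graded_resolution V J s \<epsilon> D" and G': "graded_resolution V L t \<eta> E"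
    using F G by (simp_all add: minimal_graded_resolution_iff)
  have fL: "f * r \<in> J" if "r \<in> L" for r using L that by blast
  note Jadd = ideal_poly_ringD(2)[OF ideal] and Jdiff = ideal_poly_ring_diff[OF ideal]
  obtain \<phi> where \<phi>: "\<And>i. hmat V (s i) (map ((+) d) (t i)) (\<phi> i)"
      and \<phi>0: "entries_in J (f \<cdot>\<^sub>m row_mat \<eta> - row_mat \<epsilon> * \<phi> 0)"
      and \<phi>E: "\<And>i. D i * \<phi> (Suc i) = \<phi> i * E i"
    using comparison[OF F' G' ideal hom f fL] by blast
  note \<epsilon> = res_eps[OF F'] and \<eta> = res_eps[OF G']
  note hD = res_hmat[OF F'] and hE = res_hmat[OF G']
  note dD = hmat_carrier[OF hD] and dE = hmat_carrier[OF hE]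
  have d\<phi>: "\<phi> i \<in> carrier_mat (length (s i)) (length (t i))" for i using hmat_carrier[OF \<phi>[of i]] by simp
  have h\<phi>: "\<phi> i *\<^sub>v b \<in> free_module V (length (s i))" if "b \<in> free_module V (length (t i))" for i b
    using hmat_mult_vec[OF \<phi>] that by simp
  have Df: "D i *\<^sub>v c \<in> free_module V (length (s i))" if "c \<in> free_module V (length (s (Suc i)))" for i c
    using hmat_mult_vec[OF hD that] .
  have Ef: "E i *\<^sub>v b \<in> free_module V (length (t i))" if "b \<in> free_module V (length (t (Suc i)))" for i b
    using hmat_mult_vec[OF hE that] .
  note fm = Df Ef h\<phi> free_module_add free_module_diff free_module_uminus
  note fc = free_module_carrier
  have lsd: "length (shift_degs d t i) = length (shift_degs 0 t i)" for i
    by (simp add: shift_degs_def split: nat.split)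
  have lsS: "length (shift_degs 0 t (Suc i)) = length (t i)" for i by (simp add: shift_degs_def)
  have hE': "hmat V (shift_degs d t i) (shift_degs d t (Suc i)) (shift_diff t E i)" for i
  proof (cases i)
    case 0
    then show ?thesis by (simp add: shift_degs_def shift_diff_def hmat_def)
  next
    case (Suc j)
    then show ?thesis using hE[of j] by (simp add: shift_degs_def shift_diff_def hmat_shift hmat_uminus)
  qed
  have dE': "shift_diff t E i \<in> carrier_mat (length (shift_degs 0 t i)) (length (t i))" for i
    using hmat_carrier[OF hE'[of i]] lsd lsS by metis
  let ?D = "cone_diff s t D E \<phi>" and ?s = "\<lambda>i. s i @ shift_degs d t i"
  have ls: "length (?s (Suc i)) = length (s (Suc i)) + length (t i)" for i by (simp add: shift_degs_def)
  have hcone: "hmat V (?s i) (?s (Suc i)) (?D i)" for i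
    unfolding cone_diff_def lsd[symmetric]
    using hD[of i] \<phi>[of i] hE'[of i] hmat_zero[of V "shift_degs d t i" "s (Suc i)"]
    by (intro hmat_four_block) (simp_all add: shift_degs_def)
  have app: "?D i *\<^sub>v (c @\<^sub>v b) = (D i *\<^sub>v c + \<phi> i *\<^sub>v b) @\<^sub>v (shift_diff t E i *\<^sub>v b)"
    if c: "c \<in> free_module V (length (s (Suc i)))" and b: "b \<in> free_module V (length (t i))" for i c b
  proof -
    have z: "0\<^sub>m (length (shift_degs 0 t i)) (length (s (Suc i))) *\<^sub>v c = 0\<^sub>v (length (shift_degs 0 t i))"
      using fc[OF c] by (intro eq_vecI) auto
    have "shift_diff t E i *\<^sub>v b \<in> carrier_vec (length (shift_degs 0 t i))"
      using dE' fc[OF b] by (rule mult_mat_vec_carrier)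
    then show ?thesis
      unfolding cone_diff_def
      using four_block_mat_mult_vec[OF dD[of i] d\<phi>[of i] zero_carrier_mat dE'[of i] fc[OF c] fc[OF b]] z
      by simp
  qed
  have comm: "D i *\<^sub>v (\<phi> (Suc i) *\<^sub>v b) = \<phi> i *\<^sub>v (E i *\<^sub>v b)" if b: "b \<in> free_module V (length (t (Suc i)))" for i b
    unfolding assoc_mult_mat_vec[OF dD d\<phi> fc[OF b], symmetric] assoc_mult_mat_vec[OF d\<phi> dE fc[OF b], symmetric] \<phi>E ..
  have DD: "D i *\<^sub>v (D (Suc i) *\<^sub>v c) = 0\<^sub>v (length (s i))" if "c \<in> free_module V (length (s (Suc (Suc i))))" for i c
    using res_exact[OF F'] that Df by blast
  have EE: "E i *\<^sub>v (E (Suc i) *\<^sub>v b) = 0\<^sub>v (length (t i))" if "b \<in> free_module V (length (t (Suc (Suc i))))" for i b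
    using res_exact[OF G'] that Ef by blast
  \<comment> \<open>The congruence \<open>\<phi>0\<close> evaluated at a vector: expand in the
    entries of the matrix \<open>?M\<close>, all of which lie in \<open>J\<close>.\<close>
  have eps\<phi>: "f * (\<eta> \<bullet> b) - \<epsilon> \<bullet> (\<phi> 0 *\<^sub>v b) \<in> J" if b: "b \<in> free_module V (length (t 0))" for b
  proof -
    let ?M = "f \<cdot>\<^sub>m row_mat \<eta> - row_mat \<epsilon> * \<phi> 0"
    have d\<epsilon>: "row_mat \<epsilon> \<in> carrier_mat 1 (length (s 0))" and d\<eta>: "row_mat \<eta> \<in> carrier_mat 1 (length (t 0))"
      using row_mat_carrier fc \<epsilon> \<eta> by blast+
    have dM: "?M \<in> carrier_mat 1 (length (t 0))"
      by (auto intro!: carrier_matI simp: carrier_matD[OF d\<epsilon>] carrier_matD[OF d\<phi>])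
    have entry: "?M $$ (0, e) = f * \<eta> $ e - \<epsilon> \<bullet> col (\<phi> 0) e" if "e < length (t 0)" for e
    proof -
      have "row_mat \<eta> $$ (0, e) = \<eta> $ e"
        using that carrier_vecD[OF fc[OF \<eta>]] by (simp add: row_mat_def)
      then show ?thesis
        using that carrier_matD[OF d\<epsilon>] carrier_matD[OF d\<eta>] carrier_matD[OF d\<phi>[of 0]]
        by (simp add: row_row_mat)
    qed
    have "f * (\<eta> \<bullet> b) - \<epsilon> \<bullet> (\<phi> 0 *\<^sub>v b) = (\<Sum>e = 0..<length (t 0). b $ e * ?M $$ (0, e))"
    proof -
      have "\<epsilon> \<bullet> (\<phi> 0 *\<^sub>v b) = (\<Sum>e = 0..<length (t 0). b $ e * (\<epsilon> \<bullet> col (\<phi> 0) e))"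
        using carrier_matD[OF d\<phi>[of 0]] carrier_vecD[OF fc[OF b]]
        unfolding scalar_prod_def
        by (simp add: scalar_prod_def sum_distrib_left sum.swap[of _ "{0..<length (s 0)}"] mult_ac)
      moreover have "f * (\<eta> \<bullet> b) = (\<Sum>e = 0..<length (t 0). b $ e * (f * \<eta> $ e))"
        using carrier_vecD[OF fc[OF b]] by (simp add: scalar_prod_def sum_distrib_left mult_ac)
      ultimately show ?thesis
        by (simp add: entry right_diff_distrib sum_subtractf)
    qed
    also have "\<dots> \<in> J"
    proof (rule ideal_poly_ring_sum[OF ideal])
      fix e assume e: "e \<in> {0..<length (t 0)}"
      have "\<forall>i < 1. \<forall>j < length (t 0). ?M $$ (i, j) \<in> J"
        using \<phi>0 unfolding entries_in_def carrier_matD[OF dM] .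
      then have "?M $$ (0, e) \<in> J" using e by (simp del: index_minus_mat)
      then show "b $ e * ?M $$ (0, e) \<in> J"
        using b e by (intro ideal_poly_ringD(3)[OF ideal]) (auto simp: free_module_def)
    qed
    finally show ?thesis .
  qed
  have eps_add: "\<epsilon> \<bullet> (a + b) = \<epsilon> \<bullet> a + \<epsilon> \<bullet> b"
    if "a \<in> free_module V (length (s 0))" "b \<in> free_module V (length (s 0))" for a b
    using scalar_prod_add_distrib[OF fc[OF \<epsilon>]] fc that by blast
  have epsD: "\<epsilon> \<bullet> (D 0 *\<^sub>v c) \<in> J" if "c \<in> free_module V (length (s 1))" for c
    using res_exact0[OF F'] Df[of c 0] that unfolding One_nat_def by blast
  \<comment> \<open>The second component of a cone cycle is a boundary. For \<open>i = 0\<close>,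
    applying \<epsilon> to the first equation gives \<open>f * (\<eta> \<bullet> b) \<in> J\<close>,
    so the colon condition puts \<open>\<eta> \<bullet> b\<close> into \<open>L\<close>; for larger
    \<open>i\<close> the second equation says directly that \<open>b\<close> is a cycle.\<close>
  have boundary: "\<exists>b' \<in> free_module V (length (t (Suc i))). b = E i *\<^sub>v b'"
    if c: "c \<in> free_module V (length (s (Suc i)))" and b: "b \<in> free_module V (length (t i))"
      and z: "D i *\<^sub>v c + \<phi> i *\<^sub>v b = 0\<^sub>v (length (s i))" "shift_diff t E i *\<^sub>v b = 0\<^sub>v (length (shift_degs 0 t i))"
    for i c b
  proof (cases i)
    case 0
    have c0: "D 0 *\<^sub>v c \<in> free_module V (length (s 0))" and b0: "\<phi> 0 *\<^sub>v b \<in> free_module V (length (s 0))"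
      using c b fm unfolding 0 by blast+
    have "\<epsilon> \<bullet> (D 0 *\<^sub>v c) + \<epsilon> \<bullet> (\<phi> 0 *\<^sub>v b) = 0"
      using eps_add[OF c0 b0] z(1) fc[OF \<epsilon>] by (simp add: 0)
    moreover have "\<epsilon> \<bullet> (D 0 *\<^sub>v c) \<in> J" using epsD c 0 by simp
    moreover have "f * (\<eta> \<bullet> b) - \<epsilon> \<bullet> (\<phi> 0 *\<^sub>v b) \<in> J" using eps\<phi> b 0 by simp
    ultimately have "f * (\<eta> \<bullet> b) \<in> J"
      using Jdiff[of "f * (\<eta> \<bullet> b) - \<epsilon> \<bullet> (\<phi> 0 *\<^sub>v b)" "\<epsilon> \<bullet> (D 0 *\<^sub>v c)"]
      by (simp add: add_eq_0_iff)
    then have "\<eta> \<bullet> b \<in> L" using L(2) scalar_prod_polys[OF \<eta>] b 0 by blast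
    then show ?thesis using res_exact0[OF G', of b] b unfolding 0 One_nat_def by blast
  next
    case (Suc j)
    have "- (E j *\<^sub>v b) = 0\<^sub>v (length (t j))"
      using z(2) carrier_matD[OF dE[of j]] carrier_vecD[OF fc[OF b]] lsS by (simp add: Suc shift_diff_def)
    then have "E j *\<^sub>v b = 0\<^sub>v (length (t j))"
      using uminus_uminus_vec uminus_zero_vec_eq by (metis uminus_zero_vec)
    then show ?thesis using res_exact[OF G', of b j] b unfolding Suc by blast
  qed
  have "graded_resolution V J' ?s \<epsilon> ?D"
    unfolding graded_resolution_def
  proof (intro conjI allI)
    have s0: "?s 0 = s 0" by (simp add: shift_degs_def)
    show "\<epsilon> \<in> free_module V (length (?s 0))" "hmat V [0] (?s 0) (row_mat \<epsilon>)"
      using \<epsilon> res_row_mat[OF F'] unfolding s0 .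
    show "hmat V (?s i) (?s (Suc i)) (?D i)" for i by (rule hcone)
    show "\<forall>g \<in> polys V. \<exists>h \<in> free_module V (length (?s 0)). g - \<epsilon> \<bullet> h \<in> J'"
    proof
      fix g :: "'a mpoly" assume g: "g \<in> polys V"
      obtain h where h: "h \<in> free_module V (length (s 0))" "g - \<epsilon> \<bullet> h \<in> J"
        using res_surj[OF F' g] by blast
      \<comment> \<open>The witness \<open>r = 0\<close> shows that membership in \<open>J\<close>
        implies membership in \<open>J'\<close>.\<close>
      have "g - \<epsilon> \<bullet> h \<in> J'"
        using h J'[of "g - \<epsilon> \<bullet> h"] polys_diff[OF g scalar_prod_polys[OF \<epsilon>]] by (metis diff_zero mult_zero_right polys_0)
      then show "\<exists>h \<in> free_module V (length (?s 0)). g - \<epsilon> \<bullet> h \<in> J'" using h unfolding s0 by blast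
    qed
    have D0: "?D 0 *\<^sub>v (c @\<^sub>v b) = D 0 *\<^sub>v c + \<phi> 0 *\<^sub>v b"
      if c: "c \<in> free_module V (length (s 1))" and b: "b \<in> free_module V (length (t 0))" for c b
      using app[of c 0 b] c b
      by (auto intro!: eq_vecI simp: shift_diff_def)
    show "{h \<in> free_module V (length (?s 0)). \<epsilon> \<bullet> h \<in> J'} = (\<lambda>h. ?D 0 *\<^sub>v h) ` free_module V (length (?s 1))"
    proof (intro equalityI subsetI)
      fix g assume "g \<in> {h \<in> free_module V (length (?s 0)). \<epsilon> \<bullet> h \<in> J'}"
      then have g: "g \<in> free_module V (length (s 0))" "\<epsilon> \<bullet> g \<in> J'" unfolding s0 by auto
      then obtain r where r: "r \<in> polys V" "\<epsilon> \<bullet> g - f * r \<in> J"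
        using J' scalar_prod_polys[OF \<epsilon>] by blast
      \<comment> \<open>Lift the cofactor \<open>r\<close> along \<eta>. Subtracting
        \<open>\<phi> 0 *\<^sub>v b\<close> from \<open>g\<close> then gives an element that
        \<epsilon> sends into \<open>J\<close>, so exactness at \<open>F\<^sub>0\<close> supplies
        \<open>c\<close>.\<close>
      obtain b where b: "b \<in> free_module V (length (t 0))" and "r - \<eta> \<bullet> b \<in> L"
        using res_surj[OF G' r(1)] by blast
      then have "f * r - f * (\<eta> \<bullet> b) \<in> J" using fL by (simp add: right_diff_distrib[symmetric])
      from Jadd[OF Jadd[OF r(2) this] eps\<phi>[OF b]]
      have "\<epsilon> \<bullet> g - \<epsilon> \<bullet> (\<phi> 0 *\<^sub>v b) \<in> J" by simp
      then have "\<epsilon> \<bullet> (g - \<phi> 0 *\<^sub>v b) \<in> J"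
        unfolding scalar_prod_minus_distrib[OF fc[OF \<epsilon>] fc[OF g(1)] fc[OF h\<phi>[OF b]]] .
      then obtain c where c: "c \<in> free_module V (length (s 1))" and "g - \<phi> 0 *\<^sub>v b = D 0 *\<^sub>v c"
        using res_exact0[OF F' free_module_diff[OF g(1) h\<phi>[OF b]]] by blast
      then have "g = ?D 0 *\<^sub>v (c @\<^sub>v b)"
        using D0[OF c b] vec_add_diff_cancel(2)[OF fc[OF g(1)] fc[OF h\<phi>[OF b]]] by simp
      moreover have "c @\<^sub>v b \<in> free_module V (length (?s 1))"
        using free_module_append[OF c b] ls[of 0] by simp
      ultimately show "g \<in> (\<lambda>h. ?D 0 *\<^sub>v h) ` free_module V (length (?s 1))" by blast
    next
      fix g assume "g \<in> (\<lambda>h. ?D 0 *\<^sub>v h) ` free_module V (length (?s 1))"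
      then obtain h where h: "h \<in> free_module V (length (s 1) + length (t 0))" "g = ?D 0 *\<^sub>v h"
        using ls[of 0] by auto
      from h(1) obtain c b where c: "c \<in> free_module V (length (s 1))" and b: "b \<in> free_module V (length (t 0))"
        and "h = c @\<^sub>v b" by (rule free_module_appendE)
      then have g: "g = D 0 *\<^sub>v c + \<phi> 0 *\<^sub>v b" using h(2) D0 by simp
      have c0: "D 0 *\<^sub>v c \<in> free_module V (length (s 0))" using Df[of c 0] c by simp
      have "\<epsilon> \<bullet> g - f * (\<eta> \<bullet> b) = \<epsilon> \<bullet> (D 0 *\<^sub>v c) - (f * (\<eta> \<bullet> b) - \<epsilon> \<bullet> (\<phi> 0 *\<^sub>v b))"
        unfolding g eps_add[OF c0 h\<phi>[OF b]] by simp
      with Jdiff[OF epsD[OF c] eps\<phi>[OF b]] have "\<epsilon> \<bullet> g - f * (\<eta> \<bullet> b) \<in> J" by (simp only:)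
      moreover have gf: "g \<in> free_module V (length (s 0))" unfolding g using c0 h\<phi>[OF b] by (rule free_module_add)
      ultimately show "g \<in> {h \<in> free_module V (length (?s 0)). \<epsilon> \<bullet> h \<in> J'}"
        using J' scalar_prod_polys[OF \<epsilon> gf] scalar_prod_polys[OF \<eta> b] unfolding s0 by blast
    qed
    fix i
    show "{h \<in> free_module V (length (?s (Suc i))). ?D i *\<^sub>v h = 0\<^sub>v (length (?s i))} =
      (\<lambda>h. ?D (Suc i) *\<^sub>v h) ` free_module V (length (?s (Suc (Suc i))))"
    proof (intro equalityI subsetI)
      fix h assume "h \<in> {h \<in> free_module V (length (?s (Suc i))). ?D i *\<^sub>v h = 0\<^sub>v (length (?s i))}"
      then have h: "h \<in> free_module V (length (s (Suc i)) + length (t i))"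
          and Dh: "?D i *\<^sub>v h = 0\<^sub>v (length (?s i))"
        unfolding ls by auto
      from h obtain c b where c: "c \<in> free_module V (length (s (Suc i)))" and b: "b \<in> free_module V (length (t i))"
        and hcb: "h = c @\<^sub>v b" by (rule free_module_appendE)
      have "0\<^sub>v (length (?s i)) = (0\<^sub>v (length (s i)) @\<^sub>v 0\<^sub>v (length (shift_degs 0 t i)) :: 'a mpoly vec)"
        using lsd[of i] by (auto intro!: eq_vecI)
      then have "(D i *\<^sub>v c + \<phi> i *\<^sub>v b) @\<^sub>v (shift_diff t E i *\<^sub>v b) =
          0\<^sub>v (length (s i)) @\<^sub>v 0\<^sub>v (length (shift_degs 0 t i))"
        using Dh app[OF c b] hcb by simp
      moreover have "D i *\<^sub>v c + \<phi> i *\<^sub>v b \<in> carrier_vec (length (s i))"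
        using fc[OF free_module_add[OF Df[OF c] h\<phi>[OF b]]] .
      ultimately have z: "D i *\<^sub>v c + \<phi> i *\<^sub>v b = 0\<^sub>v (length (s i))"
          "shift_diff t E i *\<^sub>v b = 0\<^sub>v (length (shift_degs 0 t i))"
        using append_vec_eq[OF _ zero_carrier_vec] by blast+
      \<comment> \<open>Adding the image of \<open>b'\<close> under \<phi> turns \<open>c\<close>
        into a cycle of \<open>F\<close>, hence the image of some \<open>c'\<close>. The preimage of
        the cone cycle is \<open>c'\<close> together with \<open>- b'\<close>, the sign matching
        that of \<open>shift_diff\<close>.\<close>
      obtain b' where b': "b' \<in> free_module V (length (t (Suc i)))" and bE: "b = E i *\<^sub>v b'"
        using boundary[OF c b z] by blast
      have \<phi>b': "\<phi> (Suc i) *\<^sub>v b' \<in> free_module V (length (s (Suc i)))" using b' by (rule h\<phi>)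
      have "D i *\<^sub>v (c + \<phi> (Suc i) *\<^sub>v b') = 0\<^sub>v (length (s i))"
        using mult_add_distrib_mat_vec[OF dD fc[OF c] fc[OF \<phi>b']] comm[OF b'] z(1) bE by simp
      then obtain c' where c': "c' \<in> free_module V (length (s (Suc (Suc i))))"
          and eq: "c + \<phi> (Suc i) *\<^sub>v b' = D (Suc i) *\<^sub>v c'"
        using res_exact[OF F' free_module_add[OF c \<phi>b']] by blast
      have nb: "- b' \<in> free_module V (length (t (Suc i)))" using b' by (rule free_module_uminus)
      have "?D (Suc i) *\<^sub>v (c' @\<^sub>v - b') = h"
      proof -
        have "D (Suc i) *\<^sub>v c' + \<phi> (Suc i) *\<^sub>v (- b') = c"
        proof -
          have "\<phi> (Suc i) *\<^sub>v (- b') = - (\<phi> (Suc i) *\<^sub>v b')"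
            by (rule mult_mat_uminus_vec[OF d\<phi> fc[OF b']])
          then show ?thesis
            using eq vec_add_diff_cancel(1)[OF fc[OF c] fc[OF \<phi>b']] fc[OF c] fc[OF \<phi>b']
            by (metis eq add_carrier_vec minus_add_uminus_vec)
        qed
        moreover have "shift_diff t E (Suc i) *\<^sub>v (- b') = b"
          using carrier_matD[OF dE[of i]] carrier_vecD[OF fc[OF b']] unfolding bE
          by (intro eq_vecI) (auto simp: shift_diff_def)
        ultimately show ?thesis using app[OF c' nb] hcb by simp
      qed
      moreover have "c' @\<^sub>v - b' \<in> free_module V (length (?s (Suc (Suc i))))"
        unfolding ls by (rule free_module_append[OF c' nb])
      ultimately show "h \<in> (\<lambda>h. ?D (Suc i) *\<^sub>v h) ` free_module V (length (?s (Suc (Suc i))))" by blast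
    next
      fix h assume "h \<in> (\<lambda>h. ?D (Suc i) *\<^sub>v h) ` free_module V (length (?s (Suc (Suc i))))"
      then obtain x where x: "x \<in> free_module V (length (s (Suc (Suc i))) + length (t (Suc i)))"
          and h: "h = ?D (Suc i) *\<^sub>v x"
        unfolding ls by blast
      from x obtain c b where c: "c \<in> free_module V (length (s (Suc (Suc i))))" and b: "b \<in> free_module V (length (t (Suc i)))"
        and "x = c @\<^sub>v b" by (rule free_module_appendE)
      moreover have "shift_diff t E (Suc i) *\<^sub>v b = - (E i *\<^sub>v b)"
        using carrier_matD[OF dE[of i]] carrier_vecD[OF fc[OF b]] by (simp add: shift_diff_def)
      ultimately have h: "h = (D (Suc i) *\<^sub>v c + \<phi> (Suc i) *\<^sub>v b) @\<^sub>v - (E i *\<^sub>v b)"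
        using h app by simp
      have Dc: "D (Suc i) *\<^sub>v c \<in> free_module V (length (s (Suc i)))" using c by (rule Df)
      have \<phi>b: "\<phi> (Suc i) *\<^sub>v b \<in> free_module V (length (s (Suc i)))" using b by (rule h\<phi>)
      have Eb: "E i *\<^sub>v b \<in> free_module V (length (t i))" using b by (rule Ef)
      \<comment> \<open>The chain map identity cancels \<open>D \<phi> b\<close> against
        \<open>\<phi> E b\<close>, which carries the opposite sign.\<close>
      have fst: "D i *\<^sub>v (D (Suc i) *\<^sub>v c + \<phi> (Suc i) *\<^sub>v b) + \<phi> i *\<^sub>v (- (E i *\<^sub>v b)) = 0\<^sub>v (length (s i))"
      proof -
        have "\<phi> i *\<^sub>v (- (E i *\<^sub>v b)) = - (\<phi> i *\<^sub>v (E i *\<^sub>v b))"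
          by (rule mult_mat_uminus_vec[OF d\<phi> fc[OF Eb]])
        then show ?thesis
          using mult_add_distrib_mat_vec[OF dD fc[OF Dc] fc[OF \<phi>b]] DD[OF c] comm[OF b] fc[OF h\<phi>[OF Eb]]
          by simp
      qed
      have snd: "shift_diff t E i *\<^sub>v (- (E i *\<^sub>v b)) = 0\<^sub>v (length (shift_degs 0 t i))"
      proof (cases i)
        case 0
        then show ?thesis by (auto intro!: eq_vecI simp: shift_diff_def shift_degs_def)
      next
        case (Suc j)
        let ?x = "E (Suc j) *\<^sub>v b"
        have x: "?x \<in> carrier_vec (length (t (Suc j)))" using fc[OF Eb] unfolding Suc .
        have "shift_diff t E i *\<^sub>v (- ?x) = - (E j *\<^sub>v (- ?x))"
          using carrier_matD[OF dE[of j]] carrier_matD[OF dE[of "Suc j"]] by (simp add: Suc shift_diff_def)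
        also have "\<dots> = - (- (E j *\<^sub>v ?x))"
          unfolding mult_mat_uminus_vec[OF dE x] ..
        also have "\<dots> = 0\<^sub>v (length (t j))"
          using EE[of b j] b by (simp add: Suc)
        finally show ?thesis by (simp add: Suc shift_degs_def)
      qed
      have hf: "D (Suc i) *\<^sub>v c + \<phi> (Suc i) *\<^sub>v b \<in> free_module V (length (s (Suc i)))"
        "- (E i *\<^sub>v b) \<in> free_module V (length (t i))"
        using free_module_add[OF Dc \<phi>b] free_module_uminus[OF Eb] .
      have "?D i *\<^sub>v h = 0\<^sub>v (length (?s i))"
        unfolding h app[OF hf] fst snd using lsd[of i] by (auto intro!: eq_vecI)
      then show "h \<in> {h \<in> free_module V (length (?s (Suc i))). ?D i *\<^sub>v h = 0\<^sub>v (length (?s i))}"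
        unfolding ls h using free_module_append[OF hf] by simp
    qed
  qed
  moreover have "const_term (?D i $$ (p, q)) = 0" if pq: "p < length (?s i)" "q < length (?s (Suc i))" for i p q
  proof -
    have D0: "\<And>i p q. p < length (s i) \<Longrightarrow> q < length (s (Suc i)) \<Longrightarrow> const_term (D i $$ (p, q)) = 0"
      and E0: "\<And>i p q. p < length (t i) \<Longrightarrow> q < length (t (Suc i)) \<Longrightarrow> const_term (E i $$ (p, q)) = 0"
      using F G by (auto simp: minimal_graded_resolution_iff)
    \<comment> \<open>The blocks from \<open>D\<close> and \<open>E\<close> are minimal by
      assumption; those from \<phi> have entries of nonzero degree by \<open>deg\<close>.\<close>
    have \<phi>0: "const_term (\<phi> i $$ (p, q)) = 0" if "p < length (s i)" "q < length (t i)" for p q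
    proof (rule const_term_homogeneous)
      show "homogeneous (d + t i ! q - s i ! p) (\<phi> i $$ (p, q))"
        using \<phi>[of i] that by (simp add: hmat_def)
      show "d + t i ! q - s i ! p \<noteq> 0" using deg[of "s i ! p" i "t i ! q"] that by simp
    qed
    have E'0: "const_term (shift_diff t E i $$ (p, q)) = 0"
      if "p < length (shift_degs 0 t i)" "q < length (t i)" for p q
    proof (cases i)
      case 0
      then show ?thesis using that by (simp add: shift_degs_def)
    next
      case (Suc j)
      have "shift_diff t E i $$ (p, q) = - E j $$ (p, q)"
        using that carrier_matD[OF dE[of j]] by (simp add: Suc shift_diff_def shift_degs_def)
      then show ?thesis using E0[of p j q] that const_term_diff[of 0 "E j $$ (p, q)"]
        by (simp add: Suc shift_degs_def)
    qed
    show ?thesis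
      using pq carrier_matD[OF dD[of i]] carrier_matD[OF dE'[of i]] lsd[of i] ls[of i] D0 \<phi>0 E'0
      unfolding cone_diff_def by auto
  qed
  ultimately show ?thesis by (auto simp: minimal_graded_resolution_iff)
qed


section \<open>Threshold graphs\<close>

text \<open>Hides the maps, since later arguments track only the degree lists. The type argument
  fixes the coefficient field.\<close>

definition has_resolution :: "'a::field itself \<Rightarrow> nat set \<Rightarrow> (nat set \<Rightarrow> bool) \<Rightarrow> (nat \<Rightarrow> int list) \<Rightarrow> bool" where
  "has_resolution _ V K s \<longleftrightarrow> (\<exists>\<epsilon> D. minimal_graded_resolution V (mon_ideal V K :: 'a mpoly set) s \<epsilon> D)"

lemma has_resolution_cong:
  "has_resolution T V K s \<Longrightarrow> (\<And>X. K X = K' X) \<Longrightarrow> (\<And>i. s i = s' i) \<Longrightarrow> has_resolution T V K' s'"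
  using ext[of K K'] ext[of s s'] by simp

text \<open>\<open>mapping_cone\<close> with \<open>f = sqfree_mon S\<close>; its conditions on the
  colon ideal and the enlarged ideal are \<open>mon_ideal_colon\<close> and
  \<open>mon_ideal_insert\<close>.\<close>

lemma has_resolution_insert:
  assumes K: "up_closed K" and S: "finite S" "S \<subseteq> V"
    and F: "has_resolution TYPE('a::field) V K s" and G: "has_resolution TYPE('a) V (\<lambda>X. K (S \<union> X)) t"
    and deg: "\<And>i a b. a \<in> set (s i) \<Longrightarrow> b \<in> set (t i) \<Longrightarrow> a \<noteq> int (card S) + b"
  shows "has_resolution TYPE('a) V (\<lambda>X. K X \<or> S \<subseteq> X) (\<lambda>i. s i @ shift_degs (int (card S)) t i)"
proof -
  obtain \<epsilon> D \<eta> E where FD: "minimal_graded_resolution V (mon_ideal V K :: 'a mpoly set) s \<epsilon> D"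
      and GE: "minimal_graded_resolution V (mon_ideal V (\<lambda>X. K (S \<union> X)) :: 'a mpoly set) t \<eta> E"
    using F G unfolding has_resolution_def by blast
  have "\<exists>D'. minimal_graded_resolution V (mon_ideal V (\<lambda>X. K X \<or> S \<subseteq> X) :: 'a mpoly set)
      (\<lambda>i. s i @ shift_degs (int (card S)) t i) \<epsilon> D'"
  proof (rule mapping_cone[OF FD GE ideal_mon_ideal[OF K] mon_ideal_hom_part
        sqfree_mon_polys[OF S] homogeneous_sqfree_mon[OF S(1)] _ _ _ deg])
    show "mon_ideal V (\<lambda>X. K (S \<union> X)) \<subseteq> (polys V :: 'a mpoly set)" by (auto simp: mon_ideal_def)
  qed (simp_all add: mon_ideal_colon[OF S] mon_ideal_insert[OF S K])
  then show ?thesis unfolding has_resolution_def by blast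
qed

text \<open>The quotient is \<open>R\<close> itself, which is free on one generator of degree
  0.\<close>

lemma has_resolution_zero_ideal:
  "has_resolution TYPE('a::field) V (\<lambda>X. False) (\<lambda>i. if i = 0 then [0] else [])"
proof -
  let ?s = "\<lambda>i::nat. if i = 0 then [0::int] else []"
  let ?\<epsilon> = "vec 1 (\<lambda>_. 1) :: 'a mpoly vec" and ?D = "\<lambda>i. 0\<^sub>m (length (?s i)) 0 :: 'a mpoly mat"
  have J: "mon_ideal V (\<lambda>X. False) = {0 :: 'a mpoly}"
    by (auto simp: mon_ideal_def in_keys_iff intro!: poly_mapping_eqI)
  have free0: "free_module V 0 = {0\<^sub>v 0 :: 'a mpoly vec}"
    by (auto simp: free_module_def)
  have mult: "0\<^sub>m r 0 *\<^sub>v 0\<^sub>v 0 = (0\<^sub>v r :: 'a mpoly vec)" for r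
    by (intro eq_vecI) auto
  have "graded_resolution V {0 :: 'a mpoly} ?s ?\<epsilon> ?D"
    unfolding graded_resolution_def
  proof (intro conjI allI)
    show "?\<epsilon> \<in> free_module V (length (?s 0))" by (simp add: free_module_def)
    show "hmat V [0] (?s 0) (row_mat ?\<epsilon>)" by (simp add: hmat_def row_mat_def homogeneous_1)
    show "hmat V (?s i) (?s (Suc i)) (?D i)" for i by (simp add: hmat_def)
    show "\<forall>g \<in> polys V. \<exists>f \<in> free_module V (length (?s 0)). g - ?\<epsilon> \<bullet> f \<in> {0}"
    proof
      fix g :: "'a mpoly" assume "g \<in> polys V"
      then show "\<exists>f \<in> free_module V (length (?s 0)). g - ?\<epsilon> \<bullet> f \<in> {0}"
        by (intro bexI[of _ "vec 1 (\<lambda>_. g)"]) (auto simp: free_module_def scalar_prod_def)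
    qed
    have "f = 0\<^sub>v 1" if "f \<in> free_module V 1" "?\<epsilon> \<bullet> f = 0" for f :: "'a mpoly vec"
      using that by (intro eq_vecI) (auto simp: free_module_def scalar_prod_def)
    moreover have "(0\<^sub>v 1 :: 'a mpoly vec) \<in> free_module V 1" by (simp add: free_module_def)
    moreover have "?\<epsilon> \<bullet> 0\<^sub>v 1 = 0" by (rule scalar_prod_right_zero) simp
    ultimately have "{f \<in> free_module V 1. ?\<epsilon> \<bullet> f \<in> {0}} = {0\<^sub>v 1 :: 'a mpoly vec}"
      by blast
    then show "{f \<in> free_module V (length (?s 0)). ?\<epsilon> \<bullet> f \<in> {0}} = (\<lambda>f. ?D 0 *\<^sub>v f) ` free_module V (length (?s 1))"
      using mult[of 1] by (simp add: free0)
    show "{f \<in> free_module V (length (?s (Suc i))). ?D i *\<^sub>v f = 0\<^sub>v (length (?s i))} =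
        (\<lambda>f. ?D (Suc i) *\<^sub>v f) ` free_module V (length (?s (Suc (Suc i))))" for i
      using mult[of 0] mult[of "length (?s i)"] by (auto simp: free0)
  qed
  then have "minimal_graded_resolution V {0 :: 'a mpoly} ?s ?\<epsilon> ?D"
    by (simp add: minimal_graded_resolution_iff)
  then show ?thesis unfolding has_resolution_def J by blast
qed

text \<open>The Koszul complex as an iterated cone. A new variable leaves the ideal of the others
  unchanged under colon, so each step takes the cone of two copies of one resolution, and the ranks
  add by Pascal's rule.\<close>

lemma has_resolution_variables:
  assumes "finite W" "W \<subseteq> V"
  shows "has_resolution TYPE('a::field) V (\<lambda>X. X \<inter> W \<noteq> {}) (\<lambda>i. replicate (card W choose i) (int i))"
  using assms
proof (induction W rule: finite_induct)
  case empty
  show ?case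
    by (rule has_resolution_cong[OF has_resolution_zero_ideal]) auto
next
  case (insert w W)
  let ?K = "\<lambda>X. X \<inter> W \<noteq> {}" and ?s = "\<lambda>i. replicate (card W choose i) (int i)"
  have "has_resolution TYPE('a) V (\<lambda>X. ?K X \<or> {w} \<subseteq> X) (\<lambda>i. ?s i @ shift_degs (int (card {w})) ?s i)"
  proof (rule has_resolution_insert)
    show "has_resolution TYPE('a) V ?K ?s" using insert by blast
    \<comment> \<open>Since \<open>w\<close> is not in \<open>W\<close>, joining it to
      \<open>X\<close> does not affect whether \<open>X\<close> meets \<open>W\<close>.\<close>
    then show "has_resolution TYPE('a) V (\<lambda>X. ?K ({w} \<union> X)) ?s"
      using insert(2) by (auto elim!: has_resolution_cong)
  qed (use insert in \<open>auto simp: up_closed_def\<close>)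
  then show ?case
    by (rule has_resolution_cong)
      (use insert in \<open>auto simp: shift_degs_def replicate_add[symmetric] add.commute split: nat.split\<close>)
qed

text \<open>The degrees of a 2-linear resolution of a cyclic module.\<close>

definition linear_degs :: "(nat \<Rightarrow> nat) \<Rightarrow> nat \<Rightarrow> int list" where
  "linear_degs b i = (if i = 0 then [0] else replicate (b i) (int i + 1))"

text \<open>The colon ideal is generated by the variables in \<open>W\<close>, so its Koszul
  resolution enters one homological place later and twisted by 2: place \<open>i\<close> receives
  degree \<open>(i - 1) + 2 = i + 1\<close>, and linearity persists. The cone is minimal because the
  source degree \<open>i + 2\<close> never occurs in place \<open>i\<close> of the target.\<close>

lemma has_resolution_linear_quotient:
  assumes K: "up_closed K" and S: "S \<subseteq> V" "card S = 2"
    and F: "has_resolution TYPE('a::field) V K (linear_degs b)"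
    and W: "finite W" "W \<subseteq> V" "\<And>X. K (S \<union> X) \<longleftrightarrow> X \<inter> W \<noteq> {}"
  shows "has_resolution TYPE('a) V (\<lambda>X. K X \<or> S \<subseteq> X) (linear_degs (\<lambda>i. b i + (card W choose (i - 1))))"
proof -
  let ?t = "\<lambda>i. replicate (card W choose i) (int i)"
  have fin: "finite S" using S(2) by (simp add: card_ge_0_finite)
  have "has_resolution TYPE('a) V (\<lambda>X. K X \<or> S \<subseteq> X) (\<lambda>i. linear_degs b i @ shift_degs (int (card S)) ?t i)"
    by (rule has_resolution_insert[OF K fin S(1) F])
      (use has_resolution_variables[OF W(1,2), where 'a = 'a] W(3) S(2) in
        \<open>auto simp: linear_degs_def split: if_splits\<close>)
  then show ?thesis
    by (rule has_resolution_cong)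
      (auto simp: linear_degs_def shift_degs_def S(2) replicate_add add.commute split: nat.split)
qed

text \<open>The supports of monomials in the nonedge ideal for \<open>\<sigma> = A\<close>, the
  nonedges being the pairs whose larger vertex lies in \<sigma>.\<close>

definition has_nonedge :: "nat set \<Rightarrow> nat set \<Rightarrow> bool" where
  "has_nonedge A X \<longleftrightarrow> (\<exists>w \<in> A. \<exists>a < w. a \<in> X \<and> w \<in> X)"

lemma up_closed_has_nonedge: "up_closed (has_nonedge A)"
  unfolding up_closed_def has_nonedge_def by (meson subsetD)

text \<open>The generators \<open>x\<^sub>u x\<^sub>b\<close> are added in increasing order of \<open>u\<close>; modulo the previous ones, the colon
  ideal of \<open>x\<^sub>u x\<^sub>b\<close> is generated by the variables indexed by \<open>A\<close> and those below \<open>u\<close>.\<close>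

lemma has_resolution_add_vertex:
  assumes A: "finite A" "A \<subseteq> {0..n}" and b: "b \<le> n" "\<And>w. w \<in> A \<Longrightarrow> b < w"
    and res: "has_resolution TYPE('a::field) {0..n} (has_nonedge A) (linear_degs \<beta>)" and "u \<le> b"
  shows "has_resolution TYPE('a) {0..n} (\<lambda>X. has_nonedge A X \<or> (\<exists>a < u. a \<in> X \<and> b \<in> X))
    (linear_degs (\<lambda>i. \<beta> i + (\<Sum>a < u. (card A + a) choose (i - 1))))"
  using \<open>u \<le> b\<close>
proof (induction u)
  case 0
  then show ?case using res by simp
next
  case (Suc u)
  let ?K = "\<lambda>X. has_nonedge A X \<or> (\<exists>a < u. a \<in> X \<and> b \<in> X)" and ?W = "A \<union> {..<u}"
  have disj: "A \<inter> {..<u} = {}" using b(2) Suc.prems by fastforce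
  then have card: "card ?W = card A + u" using A(1) by (simp add: card_Un_disjoint)
  \<comment> \<open>Every \<open>w\<close> in \<open>A\<close> exceeds both \<open>b\<close> and
    \<open>u\<close>, and every \<open>a < u\<close> differs from both, so such elements can only
    come from \<open>X\<close>. Conversely, the pairs \<open>b, w\<close> and \<open>a, b\<close>
    are supports of earlier generators.\<close>
  have colon: "?K ({u, b} \<union> X) \<longleftrightarrow> X \<inter> ?W \<noteq> {}" for X
  proof
    assume "?K ({u, b} \<union> X)"
    then consider w a where "w \<in> A" "a < w" "a \<in> {u, b} \<union> X" "w \<in> {u, b} \<union> X"
      | a where "a < u" "a \<in> {u, b} \<union> X"
      unfolding has_nonedge_def by blast
    then show "X \<inter> ?W \<noteq> {}"
    proof cases
      case 1
      then have "w \<in> X" using b(2)[of w] Suc.prems by auto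
      then show ?thesis using 1 by blast
    next
      case 2
      then have "a \<in> X" using Suc.prems by auto
      then show ?thesis using 2 by blast
    qed
  next
    assume "X \<inter> ?W \<noteq> {}"
    then consider w where "w \<in> A" "w \<in> X" | a where "a < u" "a \<in> X" by blast
    then show "?K ({u, b} \<union> X)"
    proof cases
      case 1
      then have "has_nonedge A ({u, b} \<union> X)" unfolding has_nonedge_def using b(2)[of w] by blast
      then show ?thesis ..
    next
      case 2
      then show ?thesis by blast
    qed
  qed
  have up: "up_closed ?K"
    using up_closed_has_nonedge[of A] unfolding up_closed_def by (meson subsetD)
  have "has_resolution TYPE('a) {0..n} (\<lambda>X. ?K X \<or> {u, b} \<subseteq> X)
    (linear_degs (\<lambda>i. \<beta> i + (\<Sum>a < u. (card A + a) choose (i - 1)) + (card ?W choose (i - 1))))"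
  proof (rule has_resolution_linear_quotient[OF up _ _ _ _ _ colon])
    show "has_resolution TYPE('a) {0..n} ?K (linear_degs (\<lambda>i. \<beta> i + (\<Sum>a < u. (card A + a) choose (i - 1))))"
      using Suc by simp
  qed (use A b(1) Suc.prems in auto)
  then show ?case
    by (rule has_resolution_cong) (auto simp: less_Suc_eq linear_degs_def card add.assoc)
qed

text \<open>The induction inserts a new least element \<open>b\<close>, so larger vertices come
  first. The new vertex has all of \<open>A\<close> above it, giving \<open>i_T = card A\<close>,
  and the values of \<open>i_T\<close> at the other vertices stay the same.\<close>

lemma has_resolution_has_nonedge:
  assumes "finite A" "A \<subseteq> {0..n}"
  shows "has_resolution TYPE('a::field) {0..n} (has_nonedge A)
    (linear_degs (\<lambda>i. \<Sum>w\<in>A. \<Sum>u < w. (i_T A w + u) choose (i - 1)))"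
  using assms
proof (induction A rule: finite_linorder_min_induct)
  case empty
  show ?case
    by (rule has_resolution_cong[OF has_resolution_zero_ideal]) (auto simp: has_nonedge_def linear_degs_def)
next
  case (insert b A)
  have b: "\<And>w. w \<in> A \<Longrightarrow> b < w" "b \<notin> A" using insert.hyps by auto
  have i_T: "i_T (insert b A) w = i_T A w" if "w \<in> A" for w
    using b(1)[OF that] unfolding i_T_def by (intro arg_cong[of _ _ card]) auto
  have "{w \<in> insert b A. b < w} = A" using b by auto
  then have i_Tb: "i_T (insert b A) b = card A" by (simp add: i_T_def)
  have sum: "(\<Sum>w\<in>insert b A. \<Sum>u < w. (i_T (insert b A) w + u) choose (i - 1)) =
      (\<Sum>w\<in>A. \<Sum>u < w. (i_T A w + u) choose (i - 1)) + (\<Sum>u < b. (card A + u) choose (i - 1))" for i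
    using b(2) insert.hyps(1) by (simp add: i_T i_Tb add.commute)
  have "has_resolution TYPE('a) {0..n} (\<lambda>X. has_nonedge A X \<or> (\<exists>a < b. a \<in> X \<and> b \<in> X))
    (linear_degs (\<lambda>i. (\<Sum>w\<in>A. \<Sum>u < w. (i_T A w + u) choose (i - 1)) + (\<Sum>u < b. (card A + u) choose (i - 1))))"
    using insert b by (intro has_resolution_add_vertex) auto
  then show ?case
    by (rule has_resolution_cong) (auto simp: has_nonedge_def sum linear_degs_def simp del: One_nat_def)
qed

section \<open>The nonedge ideal of a threshold graph\<close>

lemma edges_complement_iff:
  assumes "u \<noteq> v"
  shows "{u, v} \<in> edges (complement G) \<longleftrightarrow> u \<in> verts G \<and> v \<in> verts G \<and> {u, v} \<notin> edges G"
proof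
  assume "{u, v} \<in> edges (complement G)"
  then obtain a b where "{u, v} = {a, b}" "a \<in> verts G" "b \<in> verts G" "{a, b} \<notin> edges G"
    unfolding complement_def by auto
  then show "u \<in> verts G \<and> v \<in> verts G \<and> {u, v} \<notin> edges G" by (metis doubleton_eq_iff)
next
  assume "u \<in> verts G \<and> v \<in> verts G \<and> {u, v} \<notin> edges G"
  then show "{u, v} \<in> edges (complement G)" using assms unfolding complement_def by auto
qed

lemma nonedge_threshold_graph_iff:
  assumes "u < v"
  shows "{u, v} \<in> edges (complement (threshold_graph n \<sigma>)) \<longleftrightarrow> v \<le> n \<and> v \<in> \<sigma>"
proof -
  have "{u, v} \<in> edges (threshold_graph n \<sigma>) \<longleftrightarrow> v \<le> n \<and> v \<notin> \<sigma>"
    using assms by (auto simp: threshold_graph_def doubleton_eq_iff)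
  then show ?thesis
    using assms edges_complement_iff[of u v "threshold_graph n \<sigma>"] by (auto simp: threshold_graph_def)
qed

lemma var_mult_var: "u \<noteq> v \<Longrightarrow> var u * var v = (sqfree_mon {u, v} :: 'a::comm_ring_1 mpoly)"
  by (simp add: var_def sqfree_mon_def sqfree_exp_def mult_single)

text \<open>Each generator has a nonedge as its support; conversely, a monomial whose support
  contains a nonedge is divisible by the corresponding generator, so
  \<open>ideal_containing_monomials\<close> applies.\<close>

lemma nonedge_ideal_threshold_graph:
  assumes "\<sigma> \<subseteq> {1..n}"
  shows "nonedge_ideal (threshold_graph n \<sigma>) = (mon_ideal {0..n} (has_nonedge \<sigma>) :: 'a::comm_ring_1 mpoly set)"
proof -
  let ?S = "{var u * var v | u v. u \<noteq> v \<and> {u, v} \<in> edges (complement (threshold_graph n \<sigma>))} :: 'a mpoly set"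
  have verts: "verts (threshold_graph n \<sigma>) = {0..n}" by (simp add: threshold_graph_def)
  \<comment> \<open>Normalizes each generator so that its larger vertex comes second.\<close>
  have S: "?S = {sqfree_mon {u, v} | u v. u < v \<and> v \<in> \<sigma>}"
  proof (intro equalityI subsetI)
    fix p assume "p \<in> ?S"
    then obtain u v where uv: "u \<noteq> v" "{u, v} \<in> edges (complement (threshold_graph n \<sigma>))" "p = var u * var v"
      by blast
    show "p \<in> {sqfree_mon {u, v} | u v. u < v \<and> v \<in> \<sigma>}"
    proof (cases "u < v")
      case True
      then have "v \<in> \<sigma>" using uv(2) nonedge_threshold_graph_iff by blast
      with True uv(1,3) show ?thesis using var_mult_var by blast
    next
      case False
      then have "v < u" "u \<in> \<sigma>" using uv(1,2) nonedge_threshold_graph_iff[of v u] by (auto simp: insert_commute)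
      moreover have "p = sqfree_mon {v, u}"
        using uv(1,3) var_mult_var[of u v] by (simp add: insert_commute)
      ultimately show ?thesis by blast
    qed
  next
    fix p :: "'a mpoly" assume "p \<in> {sqfree_mon {u, v} | u v. u < v \<and> v \<in> \<sigma>}"
    then obtain u v where uv: "u < v" "v \<in> \<sigma>" "p = sqfree_mon {u, v}" by blast
    have ne: "u \<noteq> v" using uv(1) by simp
    moreover have "p = var u * var v" unfolding uv(3) by (rule var_mult_var[OF ne, symmetric])
    moreover have "{u, v} \<in> edges (complement (threshold_graph n \<sigma>))"
      using uv nonedge_threshold_graph_iff assms by auto
    ultimately show "p \<in> ?S" by blast
  qed
  have mem: "sqfree_mon {u, v} \<in> (mon_ideal {0..n} (has_nonedge \<sigma>) :: 'a mpoly set)" if "u < v" "v \<in> \<sigma>" for u v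
  proof -
    have "v \<le> n" using that(2) assms by auto
    then show ?thesis
      using that unfolding mon_ideal_def has_nonedge_def
      by (auto simp: sqfree_mon_polys) (auto simp: sqfree_mon_def keys_sqfree_exp)
  qed
  note ideal = ideal_mon_ideal[OF up_closed_has_nonedge, of "{0..n}", where 'a = 'a]
  have sub: "?S \<subseteq> mon_ideal {0..n} (has_nonedge \<sigma>)" unfolding S using mem by blast
  then have S_polys: "?S \<subseteq> polys {0..n}" by (auto simp: mon_ideal_def)
  show ?thesis
    unfolding nonedge_ideal_def verts
  proof (rule equalityI)
    show "Idl\<^bsub>poly_ring {0..n}\<^esub> ?S \<subseteq> mon_ideal {0..n} (has_nonedge \<sigma>)"
      by (rule genideal_poly_ring(3)[OF S_polys ideal sub])
    show "mon_ideal {0..n} (has_nonedge \<sigma>) \<subseteq> Idl\<^bsub>poly_ring {0..n}\<^esub> ?S"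
    proof
      fix p :: "'a mpoly" assume p: "p \<in> mon_ideal {0..n} (has_nonedge \<sigma>)"
      show "p \<in> Idl\<^bsub>poly_ring {0..n}\<^esub> ?S"
      proof (rule ideal_containing_monomials[OF genideal_poly_ring(1)[OF S_polys]])
        show "p \<in> polys {0..n}" using p by (simp add: mon_ideal_def)
        fix m assume "m \<in> Poly_Mapping.keys p"
        then obtain u v where "u < v" "v \<in> \<sigma>" "{u, v} \<subseteq> Poly_Mapping.keys m"
          using p by (auto simp: mon_ideal_def has_nonedge_def)
        then have "sqfree_mon {u, v} \<in> ?S" "\<exists>r. m = r + sqfree_exp {u, v}"
          unfolding S using split_monomial[of "{u, v}" m] by blast+
        then show "\<exists>l. (Poly_Mapping.single l 1 :: 'a mpoly) \<in> Idl\<^bsub>poly_ring {0..n}\<^esub> ?S \<and> (\<exists>r. m = r + l)"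
          using genideal_poly_ring(2)[OF S_polys] unfolding sqfree_mon_def by blast
      qed
    qed
  qed
qed

section \<open>Betti numbers and binomial identities\<close>

text \<open>For \<open>k\<close> at least 1 the constructed resolution has all its basis elements of
  place \<open>k\<close> in degree \<open>k + 1\<close>, so the Betti number is the full rank
  there.\<close>

lemma betti_threshold_graph:
  assumes "\<sigma> \<subseteq> {1..n}" and "1 \<le> k"
  shows "betti TYPE('a::field) (threshold_graph n \<sigma>) k = (\<Sum>v\<in>\<sigma>. \<Sum>u < v. (i_T \<sigma> v + u) choose (k - 1))"
proof -
  let ?b = "\<lambda>i. \<Sum>v\<in>\<sigma>. \<Sum>u < v. (i_T \<sigma> v + u) choose (i - 1)"
  have \<sigma>: "finite \<sigma>" "\<sigma> \<subseteq> {0..n}" using assms(1) finite_subset by auto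
  obtain \<epsilon> D where
    "minimal_graded_resolution {0..n} (mon_ideal {0..n} (has_nonedge \<sigma>) :: 'a mpoly set) (linear_degs ?b) \<epsilon> D"
    using has_resolution_has_nonedge[OF \<sigma>, where 'a = 'a] unfolding has_resolution_def by blast
  then have "graded_betti {0..n} (mon_ideal {0..n} (has_nonedge \<sigma>) :: 'a mpoly set) k (int k + 1) =
      count_list (linear_degs ?b k) (int k + 1)"
    using mon_ideal_hom_part by (intro graded_betti_eq ideal_mon_ideal up_closed_has_nonedge)
  also have "\<dots> = ?b k"
  proof -
    have "count_list (replicate r x) x = r" for r and x :: int by (induction r) auto
    then show ?thesis using assms(2) by (simp add: linear_degs_def)
  qed
  finally show ?thesis
    unfolding betti_def nonedge_ideal_threshold_graph[OF assms(1)] by (simp add: threshold_graph_def)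
qed

text \<open>Induction by Pascal's rule; the leading term accounts for the sum starting at
  \<open>c\<close> rather than at 0.\<close>

lemma hockey_stick: "(c choose Suc k) + (\<Sum>u < v. (c + u) choose k) = ((c + v) choose Suc k)"
  by (induction v) simp_all

text \<open>Vandermonde's identity with the term \<open>j = 0\<close> split off and
  \<open>j = u + 1\<close> elsewhere. The label condition together with \<open>u < v\<close> selects
  exactly the indices at which both binomial coefficients are nonzero.\<close>

lemma vandermonde_tail:
  assumes "1 \<le> k"
  shows "(i choose k) + (\<Sum>u \<in> {u. u < v \<and> k \<in> {u + 1..u + 1 + i}}. (v choose (u + 1)) * (i choose (k - u - 1))) =
    ((i + v) choose k)"
proof -
  obtain k' where k: "k = Suc k'" using assms by (cases k) auto
  have "((i + v) choose k) = (\<Sum>j\<le>k. (v choose j) * (i choose (k - j)))"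
    using vandermonde[of v i k] by (simp add: add.commute)
  also have "\<dots> = (i choose k) + (\<Sum>u\<le>k'. (v choose Suc u) * (i choose (k' - u)))"
    unfolding k by (subst sum.atMost_Suc_shift) simp
  also have "(\<Sum>u\<le>k'. (v choose Suc u) * (i choose (k' - u))) =
      (\<Sum>u \<in> {u. u < v \<and> k \<in> {u + 1..u + 1 + i}}. (v choose (u + 1)) * (i choose (k - u - 1)))"
    by (rule sum.mono_neutral_cong_right) (auto simp: k not_less intro: binomial_eq_0)
  finally show ?thesis by simp
qed

theorem theorem3p13:
  fixes n k :: nat and \<sigma> :: "nat set"
  assumes "n \<ge> 1" and "\<sigma> \<subseteq> {1..n}" and "1 \<le> k" and "k \<le> n"
  shows "betti TYPE('a::field) (threshold_graph n \<sigma>) k =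
    (\<Sum>(u, v) \<in> beta_edges n \<sigma> k. (v choose (u + 1)) * (i_T \<sigma> v choose (k - u - 1)))"
proof -
  let ?U = "\<lambda>v. {u. u < v \<and> k \<in> {u + 1..u + 1 + i_T \<sigma> v}}"
  let ?g = "\<lambda>u v. (v choose (u + 1)) * (i_T \<sigma> v choose (k - u - 1))"
  have \<sigma>: "finite \<sigma>" using assms(2) finite_subset by auto
  \<comment> \<open>Groups the nonedges by their larger vertex \<open>v\<close>.\<close>
  have "beta_edges n \<sigma> k = prod.swap ` Sigma \<sigma> ?U"
    using assms(2) nonedge_threshold_graph_iff[of _ _ n \<sigma>]
    by (force simp: beta_edges_def beta_label_def image_iff)
  then have "(\<Sum>(u, v) \<in> beta_edges n \<sigma> k. ?g u v) = (\<Sum>(v, u) \<in> Sigma \<sigma> ?U. ?g u v)"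
    by (simp add: sum.reindex inj_on_def case_prod_unfold)
  also have "\<dots> = (\<Sum>v\<in>\<sigma>. \<Sum>u\<in>?U v. ?g u v)"
    using \<sigma> by (intro sum.Sigma[symmetric]) auto
  also have "\<dots> = (\<Sum>v\<in>\<sigma>. \<Sum>u < v. (i_T \<sigma> v + u) choose (k - 1))"
  proof (rule sum.cong[OF refl])
    fix v
    \<comment> \<open>Adding \<open>i_T \<sigma> v choose k\<close> to either side gives
      \<open>(i_T \<sigma> v + v) choose k\<close>: on the left by \<open>vandermonde_tail\<close>,
      on the right by \<open>hockey_stick\<close> at \<open>k - 1\<close>.\<close>
    show "(\<Sum>u\<in>?U v. ?g u v) = (\<Sum>u < v. (i_T \<sigma> v + u) choose (k - 1))"
      using vandermonde_tail[OF assms(3), of "i_T \<sigma> v" v] hockey_stick[of "i_T \<sigma> v" "k - 1" v] assms(3)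
      by simp
  qed
  finally show ?thesis using betti_threshold_graph[OF assms(2,3)] by simp
qed

end
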